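(* Let $J_\pm,K_\pm$ be the first-order differential operators in the spherical coordinates $(r,\theta,\varphi)$ given in the context. The real Lie algebra (under the commutator) generated by $J_+,J_-,K_+,K_-$ is isomorphic to $\mathfrak{so}(3,2)$. An isomorphism is specified by the skew-symmetric array ("tensor operator") $$({\bf M}_{ab})_{1\le a,b\le5}=\begin{pmatrix}0&\mathcal{PC}_2^-&-\mathcal{PC}_1^-&-\mathcal{PC}_3^-&-D\\-\mathcal{PC}_2^-&0&\mathcal{J}_3&-\mathcal{J}_1&\mathcal{PC}_2^+\\ \mathcal{PC}_1^-&-\mathcal{J}_3&0&\mathcal{J}_2&-\mathcal{PC}_1^+\\ \mathcal{PC}_3^-&\mathcal{J}_1&-\mathcal{J}_2&0&-\mathcal{PC}_3^+\\ D&-\mathcal{PC}_2^+&\mathcal{PC}_1^+&\mathcal{PC}_3^+&0\end{pmatrix}$$ with $\Gamma=(g_{ab})={\rm diag}(+1,+1,-1,-1,-1)$; that is, the ten elements ${\bf M}_{ab}$, $1\le a<b\le5$, form a basis of the algebra over $\mathbb{R}$ and satisfy the $\mathfrak{so}(3,2)$ commutation relations $$[{\bf M}_{ab},{\bf M}_{cd}]=g_{ad}{\bf M}_{bc}+g_{bc}{\bf M}_{ad}-g_{ac}{\bf M}_{bd}-g_{bd}{\bf M}_{ac}.$$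
   Context: With $D_r,D_\theta,D_\varphi$ the partial derivatives in $r>0$, $\theta\in(0,\pi)$, $\varphi\in\mathbb{R}$, the operators (acting on complex-valued smooth functions of $(r,\theta,\varphi)$) are $$J_\pm={\rm e}^{\pm{\rm i}\varphi}\left[\pm D_\theta+{\rm i}(\cot\theta)D_\varphi\right],$$ $$K_\pm=r^{\pm1}\left[\pm(\sin\theta)D_\theta+(\cos\theta)(rD_r+\tfrac12\pm\tfrac12)\right],$$ $$R_\pm=r^{\pm1}{\rm e}^{\pm{\rm i}\varphi}\left[\pm(\cos\theta)D_\theta+{\rm i}(\csc\theta)D_\varphi-(\sin\theta)(rD_r+\tfrac12\pm\tfrac12)\right],$$ $$S_\pm=r^{\pm1}{\rm e}^{\mp{\rm i}\varphi}\left[\mp(\cos\theta)D_\theta+{\rm i}(\csc\theta)D_\varphi+(\sin\theta)(rD_r+\tfrac12\pm\tfrac12)\right],$$ $$J_3=-{\rm i}D_\varphi,\qquad K_3=rD_r+\tfrac12,\qquad D:=K_3.$$ One has $R_\pm=\pm[J_\pm,K_\pm]$, $S_\pm=\pm[J_\mp,K_\pm]$. Further, $$(P_+,P_-,P_3):=(S_-,-R_-,K_-),\qquad(C_+,C_-,C_3):=(-R_+,S_+,K_+),$$ $$(PC^\pm_+,PC^\pm_-,PC^\pm_3):=\tfrac12\left[(P_+,P_-,P_3)\pm(C_+,C_-,C_3)\right],$$ and for $X=J,PC^+,PC^-$ the elements $\mathcal{X}_1:=(X_++X_-)/2$, $\mathcal{X}_2:=(X_+-X_-)/2$, $\mathcal{X}_3:=X_3$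 define $\mathcal{J}_i$, $\mathcal{PC}^\pm_i$. The real Lie algebra $\mathfrak{so}(p,q)$ comprises all real $(p+q)\times(p+q)$ matrices $A$ for which $\Gamma A$ is skew-symmetric, where $\Gamma$ is diagonal with $q$ entries $+1$ and $p$ entries $-1$; it has a basis ${\bf M}_{ab}$, $a<b$ (with ${\bf M}_{ba}=-{\bf M}_{ab}$), satisfying the commutation relations displayed in the claim. *)

theory Defs
  imports "HOL-Analysis.Analysis"
begin

section \<open>Smooth functions on an open set\<close>

fun Ck_on :: "nat \<Rightarrow> 'a::real_normed_vector set \<Rightarrow> ('a \<Rightarrow> 'b::real_normed_vector) \<Rightarrow> bool" where
  "Ck_on 0 S f \<longleftrightarrow> continuous_on S f"
| "Ck_on (Suc k) S f \<longleftrightarrow>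
     (\<forall>x\<in>S. f differentiable (at x)) \<and> (\<forall>v. Ck_on k S (\<lambda>x. frechet_derivative f (at x) v))"

text \<open>Only meant for open \<open>S\<close>: the derivatives are taken in the full space.\<close>

definition smooth_on :: "'a::real_normed_vector set \<Rightarrow> ('a \<Rightarrow> 'b::real_normed_vector) \<Rightarrow> bool" where
  "smooth_on S f \<longleftrightarrow> (\<forall>k. Ck_on k S f)"

lemma fderiv_works:
  "f differentiable F \<Longrightarrow> (f has_derivative frechet_derivative f F) F"
  by (simp add: frechet_derivative_works)

lemma Ck_on_cong:
  assumes "open S" "\<And>x. x \<in> S \<Longrightarrow> f x = g x" "Ck_on k S f"
  shows "Ck_on k S g"
  using assms(2,3)
proof (induction k arbitrary: f g)
  case 0
  then show ?case using continuous_on_cong[of S S f g] by simp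
next
  case (Suc k)
  have D: "(g has_derivative frechet_derivative f (at x)) (at x)" if "x \<in> S" for x
    using has_derivative_transform_within_open[OF _ assms(1) that, of f _ UNIV g] Suc.prems that
    by (simp add: fderiv_works)
  have "f differentiable (at x)" if "x \<in> S" for x using Suc.prems that by simp
  have "frechet_derivative f (at x) = frechet_derivative g (at x)" if "x \<in> S" for x
    using frechet_derivative_at[OF D[OF that]] .
  then have "Ck_on k S (\<lambda>x. frechet_derivative g (at x) v)" for v
    using Suc.IH[of "\<lambda>x. frechet_derivative f (at x) v" "\<lambda>x. frechet_derivative g (at x) v"] Suc.prems(2)
    by simp
  then show ?case using D by (auto simp: differentiable_def)
qed

lemma Ck_on_SucI:
  assumes "open S" "\<And>x. x \<in> S \<Longrightarrow> (f has_derivative f' x) (at x)"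
    "\<And>v. Ck_on k S (\<lambda>x. f' x v)"
  shows "Ck_on (Suc k) S f"
proof -
  have "f' x = frechet_derivative f (at x)" if "x \<in> S" for x
    using frechet_derivative_at[OF assms(2)[OF that]] .
  then have "Ck_on k S (\<lambda>x. frechet_derivative f (at x) v)" for v
    by (intro Ck_on_cong[OF assms(1) _ assms(3)[of v]]) simp
  then show ?thesis using assms(2) by (auto simp: differentiable_def)
qed

lemma Ck_on_SucD: "Ck_on (Suc k) S f \<Longrightarrow> Ck_on k S f"
proof (induction k arbitrary: f)
  case 0
  then show ?case
    by (auto intro!: continuous_at_imp_continuous_on differentiable_imp_continuous_within)
next
  case (Suc k)
  then show ?case by (metis Ck_on.simps(2))
qed

lemma Ck_on_const [simp]: "Ck_on k S (\<lambda>x. c)"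
  by (induction k arbitrary: c) auto

lemma Ck_on_add:
  assumes "open S" "Ck_on k S f" "Ck_on k S g"
  shows "Ck_on k S (\<lambda>x. f x + g x)"
  using assms(2,3)
proof (induction k arbitrary: f g)
  case 0
  then show ?case by (auto intro: continuous_intros)
next
  case (Suc k)
  show ?case
    by (rule Ck_on_SucI[OF assms(1), where f' = "\<lambda>x v. frechet_derivative f (at x) v + frechet_derivative g (at x) v"])
       (use Suc in \<open>auto intro!: has_derivative_add simp: fderiv_works\<close>)
qed

lemma Ck_on_mult:
  fixes f g :: "'a::real_normed_vector \<Rightarrow> 'b::real_normed_algebra"
  assumes "open S" "Ck_on k S f" "Ck_on k S g"
  shows "Ck_on k S (\<lambda>x. f x * g x)"
  using assms(2,3)
proof (induction k arbitrary: f g)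
  case 0
  then show ?case by (auto intro: continuous_intros)
next
  case (Suc k)
  show ?case
  proof (rule Ck_on_SucI[OF assms(1)])
    show "((\<lambda>x. f x * g x) has_derivative
        (\<lambda>v. f x * frechet_derivative g (at x) v + frechet_derivative f (at x) v * g x)) (at x)"
      if "x \<in> S" for x
      using Suc.prems that by (intro has_derivative_mult) (auto simp: fderiv_works)
    show "Ck_on k S (\<lambda>x. f x * frechet_derivative g (at x) v + frechet_derivative f (at x) v * g x)" for v
      using Suc.prems Suc.prems[THEN Ck_on_SucD]
      by (intro Ck_on_add[OF assms(1)] Suc.IH) auto
  qed
qed

lemma Ck_on_bounded_linear:
  fixes f :: "'a::real_normed_vector \<Rightarrow> 'b::real_normed_vector"
  assumes "open S" "bounded_linear f"
  shows "Ck_on k S f"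
proof (cases k)
  case 0
  then show ?thesis using assms linear_continuous_on by auto
next
  case (Suc m)
  show ?thesis unfolding Suc
    by (rule Ck_on_SucI[OF assms(1) bounded_linear_imp_has_derivative[OF assms(2)]]) simp
qed

lemma Ck_on_exp:
  fixes f :: "'a::real_normed_vector \<Rightarrow> complex"
  assumes "open S" "\<And>k. Ck_on k S f"
  shows "Ck_on k S (\<lambda>x. exp (f x))"
proof (induction k)
  case 0
  then show ?case using assms(2)[of 0] by (auto intro: continuous_intros)
next
  case (Suc k)
  have 1: "f differentiable (at x)" if "x \<in> S" for x using assms(2)[of "Suc 0"] that by auto
  have 2: "Ck_on k S (\<lambda>x. frechet_derivative f (at x) v)" for v using assms(2)[of "Suc k"] by auto
  show ?case
  proof (rule Ck_on_SucI[OF assms(1)])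
    show "((\<lambda>x. exp (f x)) has_derivative (\<lambda>v. exp (f x) * frechet_derivative f (at x) v)) (at x)"
      if "x \<in> S" for x
      using has_derivative_compose[OF 1[OF that, THEN fderiv_works]
          has_field_derivative_imp_has_derivative[OF DERIV_exp]] .
    show "Ck_on k S (\<lambda>x. exp (f x) * frechet_derivative f (at x) v)" for v
      by (rule Ck_on_mult[OF assms(1) Suc 2])
  qed
qed

lemma Ck_on_inverse:
  fixes f :: "'a::real_normed_vector \<Rightarrow> complex"
  assumes "open S" "\<And>k. Ck_on k S f" "\<And>x. x \<in> S \<Longrightarrow> f x \<noteq> 0"
  shows "Ck_on k S (\<lambda>x. inverse (f x))"
proof (induction k)
  case 0
  then show ?case using assms(2)[of 0] assms(3) by (auto intro: continuous_intros)
next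
  case (Suc k)
  have 1: "f differentiable (at x)" if "x \<in> S" for x using assms(2)[of "Suc 0"] that by auto
  have 2: "Ck_on k S (\<lambda>x. frechet_derivative f (at x) v)" for v using assms(2)[of "Suc k"] by auto
  show ?case
  proof (rule Ck_on_SucI[OF assms(1)])
    show "((\<lambda>x. inverse (f x)) has_derivative
        (\<lambda>v. (- 1) * (inverse (f x) * frechet_derivative f (at x) v * inverse (f x)))) (at x)"
      if "x \<in> S" for x
      using Deriv.has_derivative_inverse[OF assms(3)[OF that] 1[OF that, THEN fderiv_works]] by simp
    show "Ck_on k S (\<lambda>x. (- 1) * (inverse (f x) * frechet_derivative f (at x) v * inverse (f x)))" for v
      by (intro Ck_on_mult[OF assms(1)] Suc 2 Ck_on_const)
  qed
qed


section \<open>The space of smooth functions of $(r,\theta,\varphi)$\<close>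

definition Omega :: "(real \<times> real \<times> real) set" where
  "Omega = {0<..} \<times> {0<..<pi} \<times> UNIV"

lemma open_Omega [simp]: "open Omega"
  unfolding Omega_def by (intro open_Times) auto

definition restr :: "(real \<times> real \<times> real \<Rightarrow> complex) \<Rightarrow> real \<times> real \<times> real \<Rightarrow> complex" where
  "restr f = (\<lambda>x. if x \<in> Omega then f x else 0)"

lemma Ck_on_restr: "Ck_on k Omega f \<Longrightarrow> Ck_on k Omega (restr f)"
  by (rule Ck_on_cong[OF open_Omega]) (auto simp: restr_def)

text \<open>A function on \<open>Omega\<close> is represented by its extension by zero, so that equality of
  elements of \<open>sfun\<close> is equality on \<open>Omega\<close>.\<close>

typedef sfun = "{f :: real \<times> real \<times> real \<Rightarrow> complex. smooth_on Omega f \<and> (\<forall>x. x \<notin> Omega \<longrightarrow> f x = 0)}"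
  morphisms sfun_apply Abs_sfun
  by (rule exI[of _ "\<lambda>_. 0"]) (simp add: smooth_on_def)

setup_lifting type_definition_sfun

instantiation sfun :: "{comm_ring_1, real_vector}"
begin

lift_definition zero_sfun :: sfun is "\<lambda>_. 0"
  by (simp add: smooth_on_def)

lift_definition one_sfun :: sfun is "restr (\<lambda>_. 1)"
  by (auto simp: smooth_on_def intro: Ck_on_restr) (simp add: restr_def)

lift_definition plus_sfun :: "sfun \<Rightarrow> sfun \<Rightarrow> sfun" is "\<lambda>f g x. f x + g x"
  by (auto simp: smooth_on_def intro: Ck_on_add)

lift_definition times_sfun :: "sfun \<Rightarrow> sfun \<Rightarrow> sfun" is "\<lambda>f g x. f x * g x"
  by (auto simp: smooth_on_def intro: Ck_on_mult)

lift_definition uminus_sfun :: "sfun \<Rightarrow> sfun" is "\<lambda>f x. - f x"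
proof -
  fix f :: "real \<times> real \<times> real \<Rightarrow> complex"
  assume "smooth_on Omega f \<and> (\<forall>x. x \<notin> Omega \<longrightarrow> f x = 0)"
  then show "smooth_on Omega (\<lambda>x. - f x) \<and> (\<forall>x. x \<notin> Omega \<longrightarrow> - f x = 0)"
    using Ck_on_mult[OF open_Omega Ck_on_const[of _ _ "- 1"], of _ f] by (auto simp: smooth_on_def)
qed

definition minus_sfun :: "sfun \<Rightarrow> sfun \<Rightarrow> sfun" where
  "minus_sfun f g = f + (- g)"

lift_definition scaleR_sfun :: "real \<Rightarrow> sfun \<Rightarrow> sfun" is "\<lambda>c f x. c *\<^sub>R f x"
  by (auto simp: smooth_on_def scaleR_conv_of_real intro: Ck_on_mult)

instance
proof
  fix a b c :: sfun and s t :: real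
  show "a + b + c = a + (b + c)" "a + b = b + a" "0 + a = a" "- a + a = 0"
    by (transfer; auto)+
  show "a - b = a + - b" by (simp add: minus_sfun_def)
  show "a * b * c = a * (b * c)" "a * b = b * a" "(a + b) * c = a * c + b * c"
    by (transfer; auto simp: algebra_simps)+
  show "1 * a = a" by transfer (auto simp: restr_def)
  show "(0::sfun) \<noteq> 1"
  proof transfer
    have "(1, 1, 0) \<in> Omega" using pi_gt3 by (auto simp: Omega_def)
    then show "(\<lambda>_. 0) \<noteq> restr (\<lambda>_. 1)" by (auto simp: restr_def fun_eq_iff)
  qed
  show "s *\<^sub>R (a + b) = s *\<^sub>R a + s *\<^sub>R b" "(s + t) *\<^sub>R a = s *\<^sub>R a + t *\<^sub>R a"
    "s *\<^sub>R t *\<^sub>R a = (s * t) *\<^sub>R a" "1 *\<^sub>R a = a"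
    by (transfer; auto simp: algebra_simps)+
qed

end

lemma Ck_on_re: "Ck_on k Omega (\<lambda>(r, \<theta>, \<phi>). complex_of_real r)"
  by (rule Ck_on_bounded_linear)
     (use bounded_linear_compose[OF bounded_linear_of_real bounded_linear_fst] in \<open>simp_all add: case_prod_unfold\<close>)

lemma Ck_on_theta: "Ck_on k Omega (\<lambda>(r, \<theta>, \<phi>). complex_of_real \<theta>)"
  by (rule Ck_on_bounded_linear)
     (use bounded_linear_compose[OF bounded_linear_of_real bounded_linear_compose[OF bounded_linear_fst bounded_linear_snd]] in \<open>simp_all add: case_prod_unfold\<close>)

lemma Ck_on_phi: "Ck_on k Omega (\<lambda>(r, \<theta>, \<phi>). complex_of_real \<phi>)"
  by (rule Ck_on_bounded_linear)
     (use bounded_linear_compose[OF bounded_linear_of_real bounded_linear_compose[OF bounded_linear_snd bounded_linear_snd]] in \<open>simp_all add: case_prod_unfold\<close>)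

lemma Ck_on_power:
  fixes f :: "'a::real_normed_vector \<Rightarrow> complex"
  assumes "open S" "Ck_on k S f"
  shows "Ck_on k S (\<lambda>x. f x ^ n)"
  by (induction n) (auto intro: Ck_on_mult assms)

lemma Ck_on_rpow: "Ck_on k Omega (\<lambda>(r, \<theta>, \<phi>). complex_of_real r powi n)"
proof (cases "n \<ge> 0")
  case True
  then show ?thesis
    using Ck_on_power[OF open_Omega Ck_on_re, of k "nat n"]
    by (simp add: case_prod_unfold power_int_def)
next
  case False
  have "Ck_on k Omega (\<lambda>x. inverse (case x of (r, \<theta>, \<phi>) \<Rightarrow> complex_of_real r))"
    by (rule Ck_on_inverse[OF open_Omega Ck_on_re]) (auto simp: Omega_def)
  then show ?thesis
    using Ck_on_power[OF open_Omega, of k _ "nat (- n)"] False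
    by (simp add: case_prod_unfold power_int_def)
qed

lemma Ck_on_sin: "Ck_on k Omega (\<lambda>(r, \<theta>, \<phi>). complex_of_real (sin \<theta>))"
proof -
  have "Ck_on k Omega (\<lambda>x. inverse (2 * \<i>) * (exp (\<i> * (case x of (r, \<theta>, \<phi>) \<Rightarrow> complex_of_real \<theta>))
      + (- 1) * exp (- \<i> * (case x of (r, \<theta>, \<phi>) \<Rightarrow> complex_of_real \<theta>))))"
    by (intro Ck_on_mult Ck_on_add Ck_on_exp Ck_on_const open_Omega Ck_on_theta)
  then show ?thesis
    by (rule Ck_on_cong[OF open_Omega, rotated])
       (auto simp: sin_of_real[symmetric] sin_exp_eq field_simps)
qed

lemma Ck_on_cos: "Ck_on k Omega (\<lambda>(r, \<theta>, \<phi>). complex_of_real (cos \<theta>))"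
proof -
  have "Ck_on k Omega (\<lambda>x. inverse 2 * (exp (\<i> * (case x of (r, \<theta>, \<phi>) \<Rightarrow> complex_of_real \<theta>))
      + exp (- \<i> * (case x of (r, \<theta>, \<phi>) \<Rightarrow> complex_of_real \<theta>))))"
    by (intro Ck_on_mult Ck_on_add Ck_on_exp Ck_on_const open_Omega Ck_on_theta)
  then show ?thesis
    by (rule Ck_on_cong[OF open_Omega, rotated])
       (auto simp: cos_of_real[symmetric] cos_exp_eq field_simps)
qed

lemma Ck_on_csc: "Ck_on k Omega (\<lambda>(r, \<theta>, \<phi>). complex_of_real (1 / sin \<theta>))"
proof -
  have "sin t \<noteq> 0" if "0 < t" "t < pi" for t using sin_gt_zero[OF that] by simp
  then have "Ck_on k Omega (\<lambda>x. inverse (case x of (r, \<theta>, \<phi>) \<Rightarrow> complex_of_real (sin \<theta>)))"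
    by (intro Ck_on_inverse[OF open_Omega Ck_on_sin]) (auto simp: Omega_def)
  then show ?thesis
    by (rule Ck_on_cong[OF open_Omega, rotated]) (auto simp: divide_inverse)
qed

lemma Ck_on_cot: "Ck_on k Omega (\<lambda>(r, \<theta>, \<phi>). complex_of_real (cot \<theta>))"
  by (rule Ck_on_cong[OF open_Omega _ Ck_on_mult[OF open_Omega Ck_on_cos Ck_on_csc]])
     (auto simp: cot_def)

lemma Ck_on_ephi: "Ck_on k Omega (\<lambda>(r, \<theta>, \<phi>). exp (\<i> * of_int n * complex_of_real \<phi>))"
proof -
  have "Ck_on k Omega (\<lambda>x. exp (\<i> * of_int n * (case x of (r, \<theta>, \<phi>) \<Rightarrow> complex_of_real \<phi>)))"
    by (intro Ck_on_exp Ck_on_mult Ck_on_const open_Omega Ck_on_phi)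
  then show ?thesis by (simp add: case_prod_unfold)
qed

lift_definition cconst :: "complex \<Rightarrow> sfun" is "\<lambda>c. restr (\<lambda>_. c)"
  by (auto simp: smooth_on_def intro: Ck_on_restr) (simp add: restr_def)

lift_definition r_pow :: "int \<Rightarrow> sfun" is "\<lambda>n. restr (\<lambda>(r, \<theta>, \<phi>). complex_of_real r powi n)"
  using Ck_on_restr[OF Ck_on_rpow] by (simp add: smooth_on_def) (simp add: restr_def)

lift_definition exp_i_phi :: "int \<Rightarrow> sfun" is
  "\<lambda>n. restr (\<lambda>(r, \<theta>, \<phi>). exp (\<i> * of_int n * complex_of_real \<phi>))"
  using Ck_on_restr[OF Ck_on_ephi] by (simp add: smooth_on_def) (simp add: restr_def)

lift_definition sin_theta :: sfun is "restr (\<lambda>(r, \<theta>, \<phi>). complex_of_real (sin \<theta>))"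
  using Ck_on_restr[OF Ck_on_sin] by (simp add: smooth_on_def) (simp add: restr_def)

lift_definition cos_theta :: sfun is "restr (\<lambda>(r, \<theta>, \<phi>). complex_of_real (cos \<theta>))"
  using Ck_on_restr[OF Ck_on_cos] by (simp add: smooth_on_def) (simp add: restr_def)

lift_definition cot_theta :: sfun is "restr (\<lambda>(r, \<theta>, \<phi>). complex_of_real (cot \<theta>))"
  using Ck_on_restr[OF Ck_on_cot] by (simp add: smooth_on_def) (simp add: restr_def)

lift_definition csc_theta :: sfun is "restr (\<lambda>(r, \<theta>, \<phi>). complex_of_real (1 / sin \<theta>))"
  using Ck_on_restr[OF Ck_on_csc] by (simp add: smooth_on_def) (simp add: restr_def)

lift_definition partial :: "real \<times> real \<times> real \<Rightarrow> sfun \<Rightarrow> sfun" is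
  "\<lambda>v f. restr (\<lambda>x. frechet_derivative f (at x) v)"
proof -
  fix v and f :: "real \<times> real \<times> real \<Rightarrow> complex"
  assume f: "smooth_on Omega f \<and> (\<forall>x. x \<notin> Omega \<longrightarrow> f x = 0)"
  have "Ck_on k Omega (\<lambda>x. frechet_derivative f (at x) v)" for k
    using f by (metis Ck_on.simps(2) smooth_on_def)
  then show "smooth_on Omega (restr (\<lambda>x. frechet_derivative f (at x) v)) \<and>
      (\<forall>x. x \<notin> Omega \<longrightarrow> restr (\<lambda>x. frechet_derivative f (at x) v) x = 0)"
    by (simp add: smooth_on_def Ck_on_restr) (simp add: restr_def)
qed

lemma sfun_differentiable: "x \<in> Omega \<Longrightarrow> sfun_apply f differentiable (at x)"
  using sfun_apply[of f] by (auto simp: smooth_on_def dest: spec[of _ "Suc 0"])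

lemma sfun_has_derivative:
  "x \<in> Omega \<Longrightarrow> (sfun_apply f has_derivative (\<lambda>v. sfun_apply (partial v f) x)) (at x)"
  using fderiv_works[OF sfun_differentiable, of x f]
  by (simp add: partial.rep_eq restr_def)

lemma has_vector_derivative_along:
  assumes "(f has_derivative f') (at p)" "g t = p" "(g has_vector_derivative v) (at t)"
  shows "((\<lambda>s. f (g s)) has_vector_derivative f' v) (at t)"
  using vector_derivative_diff_chain_within[of g v t UNIV f f'] assms
  by (simp add: o_def has_derivative_at_withinI)

text \<open>Along the standard basis vectors, \<^const>\<open>partial\<close> gives the three partial derivatives.\<close>

lemma partial_r:
  assumes "(r, \<theta>, \<phi>) \<in> Omega"
  shows "((\<lambda>t. sfun_apply f (t, \<theta>, \<phi>)) has_vector_derivative sfun_apply (partial (1, 0, 0) f) (r, \<theta>, \<phi>)) (at r)"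
  by (rule has_vector_derivative_along[OF sfun_has_derivative[OF assms], of "\<lambda>t. (t, \<theta>, \<phi>)"])
     (auto intro!: has_vector_derivative_Pair derivative_eq_intros simp: zero_prod_def)

lemma partial_theta:
  assumes "(r, \<theta>, \<phi>) \<in> Omega"
  shows "((\<lambda>t. sfun_apply f (r, t, \<phi>)) has_vector_derivative sfun_apply (partial (0, 1, 0) f) (r, \<theta>, \<phi>)) (at \<theta>)"
  by (rule has_vector_derivative_along[OF sfun_has_derivative[OF assms], of "\<lambda>t. (r, t, \<phi>)"])
     (auto intro!: has_vector_derivative_Pair derivative_eq_intros simp: zero_prod_def)

lemma partial_phi:
  assumes "(r, \<theta>, \<phi>) \<in> Omega"
  shows "((\<lambda>t. sfun_apply f (r, \<theta>, t)) has_vector_derivative sfun_apply (partial (0, 0, 1) f) (r, \<theta>, \<phi>)) (at \<phi>)"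
  by (rule has_vector_derivative_along[OF sfun_has_derivative[OF assms], of "\<lambda>t. (r, \<theta>, t)"])
     (auto intro!: has_vector_derivative_Pair derivative_eq_intros simp: zero_prod_def)

lemma partial_eqI:
  assumes "(sfun_apply f has_derivative f') (at x)" "x \<in> Omega"
  shows "sfun_apply (partial v f) x = f' v"
  using has_derivative_unique[OF sfun_has_derivative[OF assms(2)] assms(1)] by (rule fun_cong)

lemma partial_outside: "x \<notin> Omega \<Longrightarrow> sfun_apply (partial v f) x = 0"
  by (simp add: partial.rep_eq restr_def)

lemma sfun_eqI: "(\<And>x. sfun_apply f x = sfun_apply g x) \<Longrightarrow> f = g"
  by (simp add: sfun_apply_inject[symmetric] fun_eq_iff)

lemma partial_add: "partial v (f + g) = partial v f + partial v g"
proof (rule sfun_eqI)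
  fix x
  show "sfun_apply (partial v (f + g)) x = sfun_apply (partial v f + partial v g) x"
  proof (cases "x \<in> Omega")
    case True
    have "(sfun_apply (f + g) has_derivative
        (\<lambda>v. sfun_apply (partial v f) x + sfun_apply (partial v g) x)) (at x)"
      unfolding plus_sfun.rep_eq by (intro has_derivative_add sfun_has_derivative True)
    then show ?thesis by (simp only: partial_eqI[OF _ True] plus_sfun.rep_eq)
  qed (simp add: partial_outside plus_sfun.rep_eq)
qed

lemma partial_mult: "partial v (f * g) = f * partial v g + partial v f * g"
proof (rule sfun_eqI)
  fix x
  show "sfun_apply (partial v (f * g)) x = sfun_apply (f * partial v g + partial v f * g) x"
  proof (cases "x \<in> Omega")
    case True
    have "(sfun_apply (f * g) has_derivative
        (\<lambda>v. sfun_apply f x * sfun_apply (partial v g) x + sfun_apply (partial v f) x * sfun_apply g x)) (at x)"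
      unfolding times_sfun.rep_eq by (intro has_derivative_mult sfun_has_derivative True)
    then show ?thesis by (simp only: partial_eqI[OF _ True] plus_sfun.rep_eq times_sfun.rep_eq)
  qed (simp add: partial_outside plus_sfun.rep_eq times_sfun.rep_eq)
qed

lemma partial_cconst: "partial v (cconst c) = 0"
proof (rule sfun_eqI)
  fix x
  show "sfun_apply (partial v (cconst c)) x = sfun_apply 0 x"
  proof (cases "x \<in> Omega")
    case True
    have "(sfun_apply (cconst c) has_derivative (\<lambda>_. 0)) (at x)"
      by (rule has_derivative_transform_within_open[OF has_derivative_const[of c] open_Omega True])
         (simp add: cconst.rep_eq restr_def)
    then show ?thesis by (simp only: partial_eqI[OF _ True] zero_sfun.rep_eq)
  qed (simp add: partial_outside zero_sfun.rep_eq)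
qed


section \<open>The algebra of complex-linear operators on smooth functions\<close>

typedef sop = "{A :: sfun \<Rightarrow> sfun. (\<forall>f g. A (f + g) = A f + A g) \<and> (\<forall>c f. A (cconst c * f) = cconst c * A f)}"
  morphisms sop_apply Abs_sop
  by (rule exI[of _ "\<lambda>f. f"]) simp

setup_lifting type_definition_sop

lemma scaleR_sfun_eq: "s *\<^sub>R f = cconst (of_real s) * f"
  by transfer (auto simp: restr_def fun_eq_iff scaleR_conv_of_real)

instantiation sop :: real_algebra_1
begin

lift_definition zero_sop :: sop is "\<lambda>_. 0" by simp

lift_definition one_sop :: sop is "\<lambda>f. f" by simp

lift_definition plus_sop :: "sop \<Rightarrow> sop \<Rightarrow> sop" is "\<lambda>A B f. A f + B f"
  by (simp add: algebra_simps)

lift_definition minus_sop :: "sop \<Rightarrow> sop \<Rightarrow> sop" is "\<lambda>A B f. A f - B f"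
  by (simp add: algebra_simps)

lift_definition uminus_sop :: "sop \<Rightarrow> sop" is "\<lambda>A f. - A f"
  by (simp add: algebra_simps)

lift_definition times_sop :: "sop \<Rightarrow> sop \<Rightarrow> sop" is "\<lambda>A B f. A (B f)"
  by simp

lift_definition scaleR_sop :: "real \<Rightarrow> sop \<Rightarrow> sop" is "\<lambda>s A f. s *\<^sub>R A f"
  by (simp add: scaleR_sfun_eq algebra_simps)

instance
proof
  fix a b c :: sop and s t :: real
  show "a + b + c = a + (b + c)" "a + b = b + a" "0 + a = a" "- a + a = 0" "a - b = a + - b"
    "a * b * c = a * (b * c)" "(a + b) * c = a * c + b * c" "a * (b + c) = a * b + a * c"
    "1 * a = a" "a * 1 = a"
    by (transfer; auto simp: algebra_simps)+
  show "(0::sop) \<noteq> 1" by transfer (metis zero_neq_one)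
  show "s *\<^sub>R (a + b) = s *\<^sub>R a + s *\<^sub>R b" "(s + t) *\<^sub>R a = s *\<^sub>R a + t *\<^sub>R a"
    "s *\<^sub>R t *\<^sub>R a = (s * t) *\<^sub>R a" "1 *\<^sub>R a = a"
    by (transfer; auto simp: algebra_simps)+
  show "s *\<^sub>R a * b = s *\<^sub>R (a * b)" by transfer simp
  show "a * s *\<^sub>R b = s *\<^sub>R (a * b)" by transfer (simp add: scaleR_sfun_eq)
qed

end

definition mult_op :: "sfun \<Rightarrow> sop" where
  "mult_op g = Abs_sop (\<lambda>f. g * f)"

lemma sop_apply_mult_op: "sop_apply (mult_op g) f = g * f"
  unfolding mult_op_def by (subst Abs_sop_inverse) (auto simp: algebra_simps)

lift_definition partial_op :: "real \<times> real \<times> real \<Rightarrow> sop" is partial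
  by (simp add: partial_add partial_mult partial_cconst)

abbreviation D_r :: sop where "D_r \<equiv> partial_op (1, 0, 0)"
abbreviation D_theta :: sop where "D_theta \<equiv> partial_op (0, 1, 0)"
abbreviation D_phi :: sop where "D_phi \<equiv> partial_op (0, 0, 1)"
abbreviation i_op :: sop where "i_op \<equiv> mult_op (cconst \<i>)"


section \<open>The first-order operators\<close>

text \<open>The signs in $J_\pm$, $K_\pm$, $R_\pm$, $S_\pm$ are passed as an integer argument
  \<open>e\<close>, which is \<open>1\<close> or \<open>-1\<close>. Products of operators are compositions.\<close>

definition J_pm :: "int \<Rightarrow> sop" where
  "J_pm e = mult_op (exp_i_phi e) * (of_int e * D_theta + i_op * mult_op cot_theta * D_phi)"

definition K_pm :: "int \<Rightarrow> sop" where
  "K_pm e = mult_op (r_pow e) *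
     (of_int e * mult_op sin_theta * D_theta
      + mult_op cos_theta * (mult_op (r_pow 1) * D_r + of_real (1/2) + of_int e * of_real (1/2)))"

definition R_pm :: "int \<Rightarrow> sop" where
  "R_pm e = mult_op (r_pow e) * mult_op (exp_i_phi e) *
     (of_int e * mult_op cos_theta * D_theta + i_op * mult_op csc_theta * D_phi
      - mult_op sin_theta * (mult_op (r_pow 1) * D_r + of_real (1/2) + of_int e * of_real (1/2)))"

definition S_pm :: "int \<Rightarrow> sop" where
  "S_pm e = mult_op (r_pow e) * mult_op (exp_i_phi (- e)) *
     (- (of_int e * mult_op cos_theta * D_theta) + i_op * mult_op csc_theta * D_phi
      + mult_op sin_theta * (mult_op (r_pow 1) * D_r + of_real (1/2) + of_int e * of_real (1/2)))"

definition J_3 :: sop where "J_3 = - (i_op * D_phi)"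

definition K_3 :: sop where "K_3 = mult_op (r_pow 1) * D_r + of_real (1/2)"

abbreviation Dil :: sop where "Dil \<equiv> K_3"

text \<open>Triples are in the order $(X_+, X_-, X_3)$.\<close>

definition J_triple :: "sop \<times> sop \<times> sop" where "J_triple = (J_pm 1, J_pm (-1), J_3)"

definition P_triple :: "sop \<times> sop \<times> sop" where "P_triple = (S_pm (-1), - R_pm (-1), K_pm (-1))"

definition C_triple :: "sop \<times> sop \<times> sop" where "C_triple = (- R_pm 1, S_pm 1, K_pm 1)"

definition PCp_triple :: "sop \<times> sop \<times> sop" where
  "PCp_triple = (1/2) *\<^sub>R (P_triple + C_triple)"

definition PCm_triple :: "sop \<times> sop \<times> sop" where
  "PCm_triple = (1/2) *\<^sub>R (P_triple - C_triple)"

fun cart1 :: "sop \<times> sop \<times> sop \<Rightarrow> sop" where "cart1 (Xp, Xm, X3) = (1/2) *\<^sub>R (Xp + Xm)"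
fun cart2 :: "sop \<times> sop \<times> sop \<Rightarrow> sop" where "cart2 (Xp, Xm, X3) = (1/2) *\<^sub>R (Xp - Xm)"
fun cart3 :: "sop \<times> sop \<times> sop \<Rightarrow> sop" where "cart3 (Xp, Xm, X3) = X3"

text \<open>Indices live in the type \<open>5\<close> of integers modulo \<open>5\<close>; the index \<open>5\<close> is the element
  \<open>0\<close> there, and \<^const>\<open>vector\<close> lists the entries with indices \<open>1, 2, 3, 4, 5\<close> in this order.\<close>

definition M_array :: "sop^5^5" where
  "M_array =
   (let J1 = cart1 J_triple; J2 = cart2 J_triple; J3 = cart3 J_triple;
        p1 = cart1 PCp_triple; p2 = cart2 PCp_triple; p3 = cart3 PCp_triple;
        m1 = cart1 PCm_triple; m2 = cart2 PCm_triple; m3 = cart3 PCm_triple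
    in vector
     [vector [  0,   m2, - m1, - m3, - Dil],
      vector [- m2,   0,   J3, - J1,    p2],
      vector [  m1, - J3,   0,   J2,  - p1],
      vector [  m3,   J1, - J2,   0,  - p3],
      vector [ Dil, - p2,   p1,  p3,     0]])"


section \<open>Lie algebras\<close>

text \<open>Real Lie algebras are given by a carrier in a real vector space together with a bracket.\<close>

definition lie_subalgebra :: "('a::real_vector \<Rightarrow> 'a \<Rightarrow> 'a) \<Rightarrow> 'a set \<Rightarrow> bool" where
  "lie_subalgebra br L \<longleftrightarrow> subspace L \<and> (\<forall>x\<in>L. \<forall>y\<in>L. br x y \<in> L)"

definition lie_iso :: "('a::real_vector \<Rightarrow> 'a \<Rightarrow> 'a) \<Rightarrow> 'a set \<Rightarrow>
    ('b::real_vector \<Rightarrow> 'b \<Rightarrow> 'b) \<Rightarrow> 'b set \<Rightarrow> ('a \<Rightarrow> 'b) \<Rightarrow> bool" where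
  "lie_iso br L br' L' F \<longleftrightarrow> bij_betw F L L' \<and>
     (\<forall>x\<in>L. \<forall>y\<in>L. F (x + y) = F x + F y) \<and> (\<forall>s. \<forall>x\<in>L. F (s *\<^sub>R x) = s *\<^sub>R F x) \<and>
     (\<forall>x\<in>L. \<forall>y\<in>L. F (br x y) = br' (F x) (F y))"

definition commutator :: "'a::ring \<Rightarrow> 'a \<Rightarrow> 'a" where
  "commutator A B = A * B - B * A"

text \<open>\<^const>\<open>times\<close> is componentwise on matrices, hence a separate bracket.\<close>

definition mat_commutator :: "real^'n^'n \<Rightarrow> real^'n^'n \<Rightarrow> real^'n^'n" where
  "mat_commutator A B = A ** B - B ** A"

definition generated_alg :: "sop set" where
  "generated_alg = lie_subalgebra commutator hull {J_pm 1, J_pm (-1), K_pm 1, K_pm (-1)}"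

text \<open>The remaining constants are only meant for index types with \<open>CARD('n) = p + q\<close>.
  The first \<open>q\<close> diagonal entries are \<open>+1\<close>, the remaining \<open>p\<close> are \<open>-1\<close>.\<close>

definition Gamma_mat :: "nat \<Rightarrow> nat \<Rightarrow> ((real, 'n::{finite, one, plus}) vec, 'n) vec" where
  "Gamma_mat p q =
     (\<chi> i j. if i = j then (vector (replicate q 1 @ replicate p (- 1)) :: (real, 'n) vec) $ i else 0)"

definition so :: "nat \<Rightarrow> nat \<Rightarrow> ((real, 'n::{finite, one, plus}) vec, 'n) vec set" where
  "so p q = {A. transpose (Gamma_mat p q ** A) = - (Gamma_mat p q ** A)}"

text \<open>The standard basis $(E_{ab} - E_{ba})\Gamma$, $a < b$, where the $E_{ab}$ are the matrix units.
  It satisfies $[X_{ab},X_{cd}] = g_{ad}X_{bc} + g_{bc}X_{ad} - g_{ac}X_{bd} - g_{bd}X_{ac}$.\<close>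

definition so_gen :: "nat \<Rightarrow> nat \<Rightarrow> 'n::{finite, one, plus} \<Rightarrow> 'n \<Rightarrow> ((real, 'n) vec, 'n) vec" where
  "so_gen p q a b =
     (\<chi> i j. (if i = a \<and> j = b then 1 else 0) - (if i = b \<and> j = a then 1 else 0)) ** Gamma_mat p q"

end

theory Submission
  imports Defs
begin

text \<open>The five functions $\xi = ((1+r^2)/2, -iy, x, z, (r^2-1)/2)$ parametrize the null cone of $\Gamma$, since
  $\xi_1^2+\xi_2^2-\xi_3^2-\xi_4^2-\xi_5^2 = 0$, and the operators \<open>M_ab\<close> are the rotations
  $X_{ab}$ of the cone written on homogeneous functions of degree $-1/2$. Multiplying the zeroth-order term
  of a first-order operator by $-2$ gives the same rotation on homogeneous functions of degree $1$,
  to which the $\xi_e$ belong; there $M_{ab}\xi_e = g_{be}\xi_a - g_{ae}\xi_b$, that is, \<open>M_ab\<close> acts on the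
  span of the $\xi_e$ by the matrix $X_{ab}$. A first-order operator is determined by its action on the $\xi_e$,
  and the $\xi_e$ are linearly independent over the reals, so that $M_{ab} \mapsto X_{ab}$ extends to an isomorphism. Finally
  $M_{ab} = [M_{a4}, M_{b4}]$ for $a, b \neq 4$, and the $M_{a4}$ are combinations of $J_\pm$, $K_\pm$.\<close>

section \<open>Symmetry of mixed partial derivatives\<close>

text \<open>Two applications of the mean value theorem: first to the difference in direction
  \<open>w\<close> as a function of the step along \<open>v\<close>, then to \<open>gv\<close> along
  \<open>w\<close>.\<close>

lemma second_difference_mean_value:
  fixes g gv gvw :: "'a::real_normed_vector \<Rightarrow> real"
  assumes h: "h > 0"
    and S: "\<And>s t. \<lbrakk>0 \<le> s; s \<le> h; 0 \<le> t; t \<le> h\<rbrakk> \<Longrightarrow> x + s *\<^sub>R v + t *\<^sub>R w \<in> S"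
    and gv: "\<And>y. y \<in> S \<Longrightarrow> ((\<lambda>s. g (y + s *\<^sub>R v)) has_real_derivative gv y) (at 0)"
    and gvw: "\<And>y. y \<in> S \<Longrightarrow> ((\<lambda>t. gv (y + t *\<^sub>R w)) has_real_derivative gvw y) (at 0)"
  obtains s t where "0 \<le> s" "s \<le> h" "0 \<le> t" "t \<le> h"
    "g (x + h *\<^sub>R v + h *\<^sub>R w) - g (x + h *\<^sub>R v) - g (x + h *\<^sub>R w) + g x
       = h * h * gvw (x + s *\<^sub>R v + t *\<^sub>R w)"
proof -
  have dv: "((\<lambda>s. g (x + s *\<^sub>R v + t *\<^sub>R w)) has_real_derivative gv (x + s *\<^sub>R v + t *\<^sub>R w)) (at s)"
    if "0 \<le> s" "s \<le> h" "0 \<le> t" "t \<le> h" for s t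
    using gv[OF S[OF that]] DERIV_shift[of "\<lambda>s. g (x + s *\<^sub>R v + t *\<^sub>R w)" _ 0 s]
    by (simp add: algebra_simps)
  have dw: "((\<lambda>t. gv (x + s *\<^sub>R v + t *\<^sub>R w)) has_real_derivative gvw (x + s *\<^sub>R v + t *\<^sub>R w)) (at t)"
    if "0 \<le> s" "s \<le> h" "0 \<le> t" "t \<le> h" for s t
    using gvw[OF S[OF that]] DERIV_shift[of "\<lambda>t. gv (x + s *\<^sub>R v + t *\<^sub>R w)" _ 0 t]
    by (simp add: algebra_simps)
  have "\<exists>s>0. s < h \<and> (g (x + h *\<^sub>R v + h *\<^sub>R w) - g (x + h *\<^sub>R v + 0 *\<^sub>R w))
        - (g (x + 0 *\<^sub>R v + h *\<^sub>R w) - g (x + 0 *\<^sub>R v + 0 *\<^sub>R w))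
      = (h - 0) * (gv (x + s *\<^sub>R v + h *\<^sub>R w) - gv (x + s *\<^sub>R v + 0 *\<^sub>R w))"
    by (rule MVT2[OF h, where f = "\<lambda>s. g (x + s *\<^sub>R v + h *\<^sub>R w) - g (x + s *\<^sub>R v + 0 *\<^sub>R w)"])
       (use h in \<open>intro DERIV_diff dv; simp\<close>)
  then obtain s where s: "0 < s" "s < h" and
    1: "(g (x + h *\<^sub>R v + h *\<^sub>R w) - g (x + h *\<^sub>R v + 0 *\<^sub>R w))
        - (g (x + 0 *\<^sub>R v + h *\<^sub>R w) - g (x + 0 *\<^sub>R v + 0 *\<^sub>R w))
      = (h - 0) * (gv (x + s *\<^sub>R v + h *\<^sub>R w) - gv (x + s *\<^sub>R v + 0 *\<^sub>R w))"
    by blast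
  have "\<exists>t>0. t < h \<and> gv (x + s *\<^sub>R v + h *\<^sub>R w) - gv (x + s *\<^sub>R v + 0 *\<^sub>R w)
      = (h - 0) * gvw (x + s *\<^sub>R v + t *\<^sub>R w)"
    by (rule MVT2[OF h]) (use s in \<open>intro dw; simp\<close>)
  then obtain t where "0 < t" "t < h" "gv (x + s *\<^sub>R v + h *\<^sub>R w) - gv (x + s *\<^sub>R v + 0 *\<^sub>R w)
      = (h - 0) * gvw (x + s *\<^sub>R v + t *\<^sub>R w)"
    by blast
  with s 1 show thesis by (intro that[of s t]) (simp_all add: algebra_simps)
qed

text \<open>The second difference of \<open>g\<close> is symmetric in \<open>v\<close> and
  \<open>w\<close>, so by \<open>second_difference_mean_value\<close> both mixed derivatives attain
  a common value arbitrarily close to \<open>x\<close>; continuity does the rest.\<close>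

lemma mixed_derivatives_eq:
  fixes g gv gw gvw gwv :: "'a::real_normed_vector \<Rightarrow> real"
  assumes S: "open S" "x \<in> S"
    and gv: "\<And>y. y \<in> S \<Longrightarrow> ((\<lambda>s. g (y + s *\<^sub>R v)) has_real_derivative gv y) (at 0)"
    and gw: "\<And>y. y \<in> S \<Longrightarrow> ((\<lambda>s. g (y + s *\<^sub>R w)) has_real_derivative gw y) (at 0)"
    and gvw: "\<And>y. y \<in> S \<Longrightarrow> ((\<lambda>t. gv (y + t *\<^sub>R w)) has_real_derivative gvw y) (at 0)"
    and gwv: "\<And>y. y \<in> S \<Longrightarrow> ((\<lambda>t. gw (y + t *\<^sub>R v)) has_real_derivative gwv y) (at 0)"
    and cont: "isCont gvw x" "isCont gwv x"
  shows "gvw x = gwv x"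
proof (rule ccontr)
  assume ne: "gvw x \<noteq> gwv x"
  \<comment> \<open>Half the gap, so that no number is within \<open>e\<close> of both
    \<open>gvw x\<close> and \<open>gwv x\<close>.\<close>
  define e where "e = \<bar>gvw x - gwv x\<bar> / 2"
  have e: "e > 0" using ne by (simp add: e_def)
  obtain d1 where d1: "d1 > 0" "\<And>y. dist y x < d1 \<Longrightarrow> \<bar>gvw y - gvw x\<bar> < e"
    using cont(1) e unfolding continuous_at_eps_delta by (force simp: dist_real_def)
  obtain d2 where d2: "d2 > 0" "\<And>y. dist y x < d2 \<Longrightarrow> \<bar>gwv y - gwv x\<bar> < e"
    using cont(2) e unfolding continuous_at_eps_delta by (force simp: dist_real_def)
  obtain d3 where d3: "d3 > 0" "ball x d3 \<subseteq> S" using S open_contains_ball by blast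
  define d where "d = min d1 (min d2 d3)"
  have d: "d > 0" using d1 d2 d3 by (simp add: d_def)
  \<comment> \<open>The parallelogram with sides \<open>h *\<^sub>R v\<close> and
    \<open>h *\<^sub>R w\<close> then stays within distance \<open>d\<close> of \<open>x\<close>;
    the summand 1 keeps the denominator positive when both vectors vanish.\<close>
  define h where "h = d / (2 * (norm v + norm w + 1))"
  have pos: "norm v + norm w + 1 > 0" by (simp add: add_nonneg_pos)
  have h: "h > 0" using d pos by (simp add: h_def)
  have close: "dist (x + s *\<^sub>R v + t *\<^sub>R w) x < d" if "0 \<le> s" "s \<le> h" "0 \<le> t" "t \<le> h" for s t
  proof -
    have "dist (x + s *\<^sub>R v + t *\<^sub>R w) x = norm (s *\<^sub>R v + t *\<^sub>R w)" by (simp add: dist_norm)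
    also have "\<dots> \<le> norm (s *\<^sub>R v) + norm (t *\<^sub>R w)" by (rule norm_triangle_ineq)
    also have "\<dots> \<le> h * norm v + h * norm w"
      using that by (auto intro!: add_mono mult_right_mono)
    also have "\<dots> \<le> h * (norm v + norm w + 1)" using h by (simp add: algebra_simps)
    also have "\<dots> = d / 2" using less_imp_neq[OF pos] by (simp add: h_def field_simps)
    finally show ?thesis using d by simp
  qed
  have inS: "x + s *\<^sub>R v + t *\<^sub>R w \<in> S" if "0 \<le> s" "s \<le> h" "0 \<le> t" "t \<le> h" for s t
    using close[OF that] d3 by (auto simp: d_def dist_commute)
  have inS': "x + s *\<^sub>R w + t *\<^sub>R v \<in> S" if "0 \<le> s" "s \<le> h" "0 \<le> t" "t \<le> h" for s t
    using inS[OF that(3,4,1,2)] by (simp add: algebra_simps)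
  obtain s t where 1: "0 \<le> s" "s \<le> h" "0 \<le> t" "t \<le> h"
    "g (x + h *\<^sub>R v + h *\<^sub>R w) - g (x + h *\<^sub>R v) - g (x + h *\<^sub>R w) + g x
       = h * h * gvw (x + s *\<^sub>R v + t *\<^sub>R w)"
    using second_difference_mean_value[OF h inS gv gvw] .
  obtain s' t' where 2: "0 \<le> s'" "s' \<le> h" "0 \<le> t'" "t' \<le> h"
    "g (x + h *\<^sub>R w + h *\<^sub>R v) - g (x + h *\<^sub>R w) - g (x + h *\<^sub>R v) + g x
       = h * h * gwv (x + s' *\<^sub>R w + t' *\<^sub>R v)"
    using second_difference_mean_value[OF h inS' gw gwv] .
  have "h * h * gvw (x + s *\<^sub>R v + t *\<^sub>R w) = h * h * gwv (x + t' *\<^sub>R v + s' *\<^sub>R w)"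
    using 1(5) 2(5) by (simp add: algebra_simps)
  then have "gvw (x + s *\<^sub>R v + t *\<^sub>R w) = gwv (x + t' *\<^sub>R v + s' *\<^sub>R w)" using h by simp
  moreover have "\<bar>gvw (x + s *\<^sub>R v + t *\<^sub>R w) - gvw x\<bar> < e"
    using close[OF 1(1-4)] by (intro d1(2)) (simp add: d_def)
  moreover have "\<bar>gwv (x + t' *\<^sub>R v + s' *\<^sub>R w) - gwv x\<bar> < e"
    using close[OF 2(3,4,1,2)] by (intro d2(2)) (simp add: d_def)
  ultimately show False unfolding e_def by argo
qed

text \<open>The mean value theorem needs real values, so complex functions are examined through real
  functionals \<open>L\<close>, later \<open>Re\<close> and \<open>Im\<close>.\<close>

lemma partial_has_derivative_line:
  assumes "y \<in> Omega" "bounded_linear L"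
  shows "((\<lambda>s. L (sfun_apply f (y + s *\<^sub>R v))) has_real_derivative L (sfun_apply (partial v f) y)) (at 0)"
proof -
  have "((\<lambda>s. sfun_apply f (y + s *\<^sub>R v)) has_vector_derivative sfun_apply (partial v f) y) (at 0)"
    by (rule has_vector_derivative_along[OF sfun_has_derivative[OF assms(1)], of "\<lambda>s. y + s *\<^sub>R v"])
       (auto intro!: derivative_eq_intros)
  then show ?thesis
    using bounded_linear.has_vector_derivative[OF assms(2)]
    by (simp add: has_real_derivative_iff_has_vector_derivative)
qed

lemma partial_commute: "partial v (partial w f) = partial w (partial v f)"
proof (rule sfun_eqI)
  fix x
  show "sfun_apply (partial v (partial w f)) x = sfun_apply (partial w (partial v f)) x"
  proof (cases "x \<in> Omega")
    case True
    have "L (sfun_apply (partial v (partial w f)) x) = L (sfun_apply (partial w (partial v f)) x)"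
      if L: "bounded_linear L" for L :: "complex \<Rightarrow> real"
    proof -
      have cont: "isCont (\<lambda>y. L (sfun_apply h y)) x" for h
        using bounded_linear.isCont[OF L] differentiable_imp_continuous_within[OF sfun_differentiable[OF True]]
        by blast
      show ?thesis
      proof (rule mixed_derivatives_eq[OF open_Omega True, where g = "\<lambda>y. L (sfun_apply f y)"
          and gvw = "\<lambda>y. L (sfun_apply (partial v (partial w f)) y)"
          and gwv = "\<lambda>y. L (sfun_apply (partial w (partial v f)) y)"])
      qed (rule cont partial_has_derivative_line[OF _ L]; assumption?)+
    qed
    then show ?thesis
      using bounded_linear_Re bounded_linear_Im by (blast intro: complex_eqI)
  qed (simp add: partial_outside)
qed

section \<open>Calculus with the basic functions and operators\<close>

lemma sfun_apply_outside: "x \<notin> Omega \<Longrightarrow> sfun_apply f x = 0"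
  using sfun_apply[of f] by blast

lemma sfun_eq_on_OmegaI:
  assumes "\<And>r \<theta> \<phi>. (r, \<theta>, \<phi>) \<in> Omega \<Longrightarrow> sfun_apply f (r, \<theta>, \<phi>) = sfun_apply g (r, \<theta>, \<phi>)"
  shows "f = g"
  using assms by (metis prod_cases3 sfun_apply_outside sfun_eqI)

text \<open>Extension by zero destroys closed formulas outside \<open>Omega\<close>. The derivative
  is therefore computed for a formula \<open>h\<close> valid on \<open>Omega\<close> and
  transferred, \<open>Omega\<close> being open.\<close>

lemma partial_eq_on_OmegaI:
  assumes "\<And>x. x \<in> Omega \<Longrightarrow> sfun_apply f x = h x"
    and "\<And>x. x \<in> Omega \<Longrightarrow> (h has_derivative h' x) (at x)"
    and "\<And>x. x \<in> Omega \<Longrightarrow> h' x v = sfun_apply g x"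
  shows "partial v f = g"
proof (rule sfun_eqI)
  fix x
  show "sfun_apply (partial v f) x = sfun_apply g x"
  proof (cases "x \<in> Omega")
    case True
    have "(sfun_apply f has_derivative h' x) (at x)"
      by (rule has_derivative_transform_within_open[OF assms(2) open_Omega]) (use True assms(1) in auto)
    then show ?thesis using partial_eqI[OF _ True] assms(3)[OF True] by metis
  qed (simp add: sfun_apply_outside)
qed

lemma sfun_apply_simps:
  assumes "(r, \<theta>, \<phi>) \<in> Omega"
  shows "sfun_apply 0 (r, \<theta>, \<phi>) = 0" "sfun_apply 1 (r, \<theta>, \<phi>) = 1"
    "sfun_apply (f + g) (r, \<theta>, \<phi>) = sfun_apply f (r, \<theta>, \<phi>) + sfun_apply g (r, \<theta>, \<phi>)"
    "sfun_apply (f - g) (r, \<theta>, \<phi>) = sfun_apply f (r, \<theta>, \<phi>) - sfun_apply g (r, \<theta>, \<phi>)"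
    "sfun_apply (- f) (r, \<theta>, \<phi>) = - sfun_apply f (r, \<theta>, \<phi>)"
    "sfun_apply (f * g) (r, \<theta>, \<phi>) = sfun_apply f (r, \<theta>, \<phi>) * sfun_apply g (r, \<theta>, \<phi>)"
    "sfun_apply (s *\<^sub>R f) (r, \<theta>, \<phi>) = of_real s * sfun_apply f (r, \<theta>, \<phi>)"
    "sfun_apply (cconst c) (r, \<theta>, \<phi>) = c"
    "sfun_apply (r_pow n) (r, \<theta>, \<phi>) = complex_of_real r powi n"
    "sfun_apply (exp_i_phi n) (r, \<theta>, \<phi>) = exp (\<i> * of_int n * of_real \<phi>)"
    "sfun_apply sin_theta (r, \<theta>, \<phi>) = sin (of_real \<theta>)"
    "sfun_apply cos_theta (r, \<theta>, \<phi>) = cos (of_real \<theta>)"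
    "sfun_apply cot_theta (r, \<theta>, \<phi>) = cos (of_real \<theta>) / sin (of_real \<theta>)"
    "sfun_apply csc_theta (r, \<theta>, \<phi>) = 1 / sin (of_real \<theta>)"
  using assms
  by (simp_all add: zero_sfun.rep_eq one_sfun.rep_eq plus_sfun.rep_eq minus_sfun_def uminus_sfun.rep_eq
      times_sfun.rep_eq scaleR_sfun.rep_eq cconst.rep_eq r_pow.rep_eq exp_i_phi.rep_eq sin_theta.rep_eq
      cos_theta.rep_eq cot_theta.rep_eq csc_theta.rep_eq restr_def scaleR_conv_of_real
      sin_of_real cos_of_real cot_def del: add_uminus_conv_diff)

lemma sfun_apply_numeral:
  assumes "x \<in> Omega"
  shows "sfun_apply (numeral n) x = numeral n"
proof -
  have "sfun_apply (of_nat k) x = of_nat k" for k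
    using assms by (induction k) (simp_all add: zero_sfun.rep_eq one_sfun.rep_eq plus_sfun.rep_eq restr_def)
  from this[of "numeral n"] show ?thesis by simp
qed

lemmas sfun_eval_simps = sfun_apply_simps sfun_apply_numeral

lemma partial_r_pow_1: "partial (a, b, c) (r_pow 1) = a *\<^sub>R 1"
  by (rule partial_eq_on_OmegaI[where h = "\<lambda>x. of_real (fst x)" and h' = "\<lambda>_ v. of_real (fst v)"])
     (auto simp: sfun_apply_simps intro!: derivative_eq_intros)

lemma partial_sin_theta: "partial (a, b, c) sin_theta = b *\<^sub>R cos_theta"
  by (rule partial_eq_on_OmegaI[where h = "\<lambda>x. of_real (sin (fst (snd x)))"
        and h' = "\<lambda>x v. of_real (fst (snd v) * cos (fst (snd x)))"])
     (auto simp: sfun_apply_simps sin_of_real cos_of_real intro!: derivative_eq_intros)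

lemma partial_cos_theta: "partial (a, b, c) cos_theta = - b *\<^sub>R sin_theta"
  by (rule partial_eq_on_OmegaI[where h = "\<lambda>x. of_real (cos (fst (snd x)))"
        and h' = "\<lambda>x v. - of_real (fst (snd v) * sin (fst (snd x)))"])
     (auto simp: sfun_apply_simps sin_of_real cos_of_real intro!: derivative_eq_intros)

lemma partial_exp_i_phi: "partial (a, b, c) (exp_i_phi n) = c *\<^sub>R (cconst (\<i> * of_int n) * exp_i_phi n)"
proof (rule partial_eq_on_OmegaI[where h = "\<lambda>x. exp (\<i> * of_int n * of_real (snd (snd x)))"
      and h' = "\<lambda>x v. of_real (snd (snd v)) * (\<i> * of_int n * exp (\<i> * of_int n * of_real (snd (snd x))))"])
  fix x :: "real \<times> real \<times> real"
  have "((\<lambda>x. \<i> * of_int n * of_real (snd (snd x))) has_derivative (\<lambda>v. \<i> * of_int n * of_real (snd (snd v)))) (at x)"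
    by (auto intro!: derivative_eq_intros)
  from has_derivative_compose[OF this has_field_derivative_imp_has_derivative[OF DERIV_exp]]
  show "((\<lambda>x. exp (\<i> * of_int n * of_real (snd (snd x)))) has_derivative
     (\<lambda>v. of_real (snd (snd v)) * (\<i> * of_int n * exp (\<i> * of_int n * of_real (snd (snd x)))))) (at x)"
    by (simp add: algebra_simps)
qed (auto simp: sfun_apply_simps)

lemma partial_scaleR: "partial v (s *\<^sub>R f) = s *\<^sub>R partial v f"
  by (simp add: scaleR_sfun_eq partial_mult partial_cconst)

lemma partial_uminus: "partial v (- f) = - partial v f"
  using partial_scaleR[of v "- 1" f] by simp

lemma partial_diff: "partial v (f - g) = partial v f - partial v g"
  using partial_add[of v f "- g"] by (simp add: partial_uminus)

lemma sfun_one_eq: "(1::sfun) = cconst 1"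
  by transfer simp

lemma partial_1: "partial v 1 = 0"
  by (simp add: sfun_one_eq partial_cconst)

lemmas partial_simps = partial_r_pow_1 partial_sin_theta partial_cos_theta partial_exp_i_phi
  partial_1 partial_cconst partial_add partial_diff partial_uminus partial_scaleR partial_mult

lemma scaleR_mult_sfun: "(s *\<^sub>R f) * g = s *\<^sub>R (f * g)" "f * (s *\<^sub>R g) = s *\<^sub>R (f * g)" for f g :: sfun
  by (simp_all add: scaleR_sfun_eq algebra_simps)

lemma sop_eqI: "(\<And>f. sop_apply A f = sop_apply B f) \<Longrightarrow> A = B"
  by (simp add: sop_apply_inject[symmetric] fun_eq_iff)

lemma sop_apply_of_int: "sop_apply (of_int n) f = of_int n * f"
proof -
  have "sop_apply (of_nat k) f = of_nat k * f" for k
    by (induction k) (simp_all add: zero_sop.rep_eq one_sop.rep_eq plus_sop.rep_eq algebra_simps)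
  then show ?thesis
    by (cases n rule: int_cases2) (simp_all add: uminus_sop.rep_eq)
qed

lemma sop_apply_of_real: "sop_apply (of_real s) f = s *\<^sub>R f"
  by (simp add: of_real_def scaleR_sop.rep_eq one_sop.rep_eq)

lemmas sop_apply_simps = zero_sop.rep_eq one_sop.rep_eq plus_sop.rep_eq minus_sop.rep_eq uminus_sop.rep_eq
  times_sop.rep_eq scaleR_sop.rep_eq sop_apply_mult_op partial_op.rep_eq sop_apply_of_int sop_apply_of_real

lemma sop_apply_add: "sop_apply A (f + g) = sop_apply A f + sop_apply A g"
  and sop_apply_cconst: "sop_apply A (cconst c * f) = cconst c * sop_apply A f"
  using sop_apply[of A] by auto

lemma sop_apply_scaleR: "sop_apply A (s *\<^sub>R f) = s *\<^sub>R sop_apply A f"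
  by (simp add: scaleR_sfun_eq sop_apply_cconst)

lemma linear_sop_apply: "linear (sop_apply A)"
  by (intro linearI sop_apply_add sop_apply_scaleR)

section \<open>First-order operators\<close>

text \<open>A tuple \<open>(a, b, c, d)\<close> is the symbol of $aD_r + bD_\theta + cD_\varphi + d$. The factor \<open>k\<close> of \<open>d\<close>
  changes the degree of homogeneity: commutators of symbols do not depend on it.\<close>

type_synonym symbol = "sfun \<times> sfun \<times> sfun \<times> sfun"

definition fop :: "real \<Rightarrow> symbol \<Rightarrow> sop" where
  "fop k = (\<lambda>(a, b, c, d). mult_op a * D_r + mult_op b * D_theta + mult_op c * D_phi + mult_op (k *\<^sub>R d))"

lemma fop_apply:
  "sop_apply (fop k (a, b, c, d)) f
     = a * partial (1, 0, 0) f + b * partial (0, 1, 0) f + c * partial (0, 0, 1) f + (k *\<^sub>R d) * f"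
  by (simp add: fop_def sop_apply_simps)

lemma linear_fop: "linear (fop k)"
  by (rule linearI; rule sop_eqI)
     (auto simp: fop_apply sop_apply_simps algebra_simps scaleR_mult_sfun)

definition symbol_bracket :: "symbol \<Rightarrow> symbol \<Rightarrow> symbol" where
  "symbol_bracket v w = (case v of (a, b, c, d) \<Rightarrow> case w of (a', b', c', d') \<Rightarrow>
     let V = sop_apply (fop 0 v); W = sop_apply (fop 0 w)
     in (V a' - W a, V b' - W b, V c' - W c, V d' - W d))"

lemma fop_split: "sop_apply (fop k (a, b, c, d)) f = sop_apply (fop 0 (a, b, c, d)) f + k *\<^sub>R (d * f)"
  by (simp add: fop_apply scaleR_mult_sfun)

lemma fop_0_mult: "sop_apply (fop 0 v) (f * g) = sop_apply (fop 0 v) f * g + f * sop_apply (fop 0 v) g"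
  by (cases v) (simp add: fop_apply partial_mult algebra_simps)

text \<open>Second-order terms cancel because partial derivatives commute, and the product of the
  two zeroth-order terms cancels because multiplications commute. What remains of order zero is
  linear in \<open>d\<close> and \<open>d'\<close>, so it scales with \<open>k\<close>, and one
  bracket of symbols serves every \<open>k\<close>.\<close>

lemma fop_symbol_bracket: "fop k (symbol_bracket v w) = commutator (fop k v) (fop k w)"
proof (rule sop_eqI)
  fix f
  obtain a b c d where v: "v = (a, b, c, d)" by (cases v)
  obtain a' b' c' d' where w: "w = (a', b', c', d')" by (cases w)
  define V where "V = sop_apply (fop 0 v)"
  define W where "W = sop_apply (fop 0 w)"
  have V: "V (g + h) = V g + V h" "V (g * h) = V g * h + g * V h" "V (s *\<^sub>R g) = s *\<^sub>R V g" for g h s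
    by (simp_all add: V_def sop_apply_add fop_0_mult sop_apply_scaleR)
  have W: "W (g + h) = W g + W h" "W (g * h) = W g * h + g * W h" "W (s *\<^sub>R g) = s *\<^sub>R W g" for g h s
    by (simp_all add: W_def sop_apply_add fop_0_mult sop_apply_scaleR)
  define f1 where "f1 = partial (1, 0, 0) f"
  define f2 where "f2 = partial (0, 1, 0) f"
  define f3 where "f3 = partial (0, 0, 1) f"
  have Vf: "V f = a * f1 + b * f2 + c * f3" and Wf: "W f = a' * f1 + b' * f2 + c' * f3"
    by (simp_all add: V_def W_def v w fop_apply f1_def f2_def f3_def)
  \<comment> \<open>These are the second-order parts of the two compositions; they agree once mixed
    partial derivatives are put in a fixed order.\<close>
  have sym: "a' * V f1 + b' * V f2 + c' * V f3 = a * W f1 + b * W f2 + c * W f3"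
    unfolding V_def W_def v w fop_apply f1_def f2_def f3_def
      partial_commute[of "(0, 1, 0)" "(1, 0, 0)"] partial_commute[of "(0, 0, 1)" "(1, 0, 0)"]
      partial_commute[of "(0, 0, 1)" "(0, 1, 0)"]
    by (simp add: algebra_simps)
  have VW: "V (W f) - W (V f) = (V a' - W a) * f1 + (V b' - W b) * f2 + (V c' - W c) * f3"
    using sym unfolding Vf Wf V W by (simp add: algebra_simps)
  have "sop_apply (commutator (fop k v) (fop k w)) f
      = V (W f) - W (V f) + k *\<^sub>R ((V d' - W d) * f)"
    unfolding commutator_def sop_apply_simps
    unfolding v w fop_split[of k]
    unfolding v[symmetric] w[symmetric] V_def[symmetric] W_def[symmetric] V W
    by (simp add: algebra_simps scaleR_mult_sfun)
  also have "\<dots> = sop_apply (fop k (symbol_bracket v w)) f"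
    unfolding VW by (simp add: symbol_bracket_def v w fop_apply f1_def f2_def f3_def V_def W_def scaleR_mult_sfun)
  finally show "sop_apply (fop k (symbol_bracket v w)) f = sop_apply (commutator (fop k v) (fop k w)) f" by simp
qed

section \<open>The standard basis of the matrix algebra\<close>

lemma exhaust_5:
  fixes x :: 5
  shows "x = 1 \<or> x = 2 \<or> x = 3 \<or> x = 4 \<or> x = 5"
proof (induct x)
  case (of_int z)
  then have "z = 0 \<or> z = 1 \<or> z = 2 \<or> z = 3 \<or> z = 4" by fastforce
  then show ?case by auto
qed

lemma UNIV_5: "UNIV = {1, 2, 3, 4, 5::5}"
  using exhaust_5 by auto

lemma sum_5: "sum f (UNIV::5 set) = f 1 + f 2 + f 3 + f 4 + f 5"
  unfolding UNIV_5 by (simp add: ac_simps)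

text \<open>Index \<open>0\<close> is listed besides \<open>5\<close> because the two are the same
  element modulo 5.\<close>

lemma vector_5 [simp]:
  "(vector [v, w, x, y, z] :: ('a::zero)^5) $ 1 = v"
  "(vector [v, w, x, y, z] :: ('a::zero)^5) $ 2 = w"
  "(vector [v, w, x, y, z] :: ('a::zero)^5) $ 3 = x"
  "(vector [v, w, x, y, z] :: ('a::zero)^5) $ 4 = y"
  "(vector [v, w, x, y, z] :: ('a::zero)^5) $ 5 = z"
  "(vector [v, w, x, y, z] :: ('a::zero)^5) $ 0 = z"
  unfolding vector_def by simp_all

abbreviation so32 :: "5 \<Rightarrow> 5 \<Rightarrow> real^5^5" where "so32 \<equiv> so_gen 3 2"

definition eta :: "5 \<Rightarrow> real" where
  "eta i = (vector [1, 1, - 1, - 1, - 1] :: real^5) $ i"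

lemma eta_simps [simp]:
  "eta 1 = 1" "eta 2 = 1" "eta 3 = - 1" "eta 4 = - 1" "eta 5 = - 1"
  unfolding eta_def by simp_all

lemma eta_square [simp]: "eta i * eta i = 1"
  using exhaust_5[of i] by auto

lemma Gamma_mat_3_2: "(Gamma_mat 3 2 :: real^5^5) $ i $ j = (if i = j then eta i else 0)"
  by (simp add: Gamma_mat_def eta_def numeral_3_eq_3 numeral_2_eq_2)

lemma so_gen_entry:
  "(so_gen 3 2 a b :: real^5^5) $ i $ j =
     ((if i = a \<and> j = b then 1 else 0) - (if i = b \<and> j = a then 1 else 0)) * eta j"
  by (simp add: so_gen_def matrix_matrix_mult_def Gamma_mat_3_2 if_distrib[of "\<lambda>x. _ * x"] cong: if_cong)

lemma so_gen_same: "so32 a a = 0"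
  unfolding vec_eq_iff so_gen_entry by simp

lemma so_gen_swap: "so32 b a = - so32 a b"
  unfolding vec_eq_iff so_gen_entry vector_uminus_component
  by (intro allI) (simp add: left_diff_distrib)

text \<open>In a product of two generators the inner \<open>Gamma_mat\<close> contracts adjacent
  indices to entries of \<open>g\<close>, leaving four matrix units times the outer
  \<open>Gamma_mat\<close>. Subtracting the reversed product pairs these units into
  generators.\<close>

lemma mat_commutator_so_gen:
  fixes a b c d :: 5
  defines "g \<equiv> \<lambda>i j. (Gamma_mat 3 2 :: real^5^5) $ i $ j"
  shows "mat_commutator (so32 a b) (so32 c d)
    = g a d *\<^sub>R so32 b c + g b c *\<^sub>R so32 a d - g a c *\<^sub>R so32 b d - g b d *\<^sub>R so32 a c"
proof -
  define \<delta> :: "5 \<Rightarrow> 5 \<Rightarrow> real" where "\<delta> i j = of_bool (i = j)" for i j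
  have g: "eta i * \<delta> i j = g i j" "g i j = g j i" for i j
    by (auto simp: g_def Gamma_mat_3_2 \<delta>_def)
  have entry: "so32 a b $ i $ j = (\<delta> i a * \<delta> j b - \<delta> i b * \<delta> j a) * eta j" for a b i j
    unfolding so_gen_entry \<delta>_def of_bool_def[symmetric] of_bool_conj by (rule refl)
  have prod: "(so32 a b ** so32 c d) $ i $ j
      = (\<delta> i a * (g b c * \<delta> j d - g b d * \<delta> j c) - \<delta> i b * (g a c * \<delta> j d - g a d * \<delta> j c)) * eta j"
    for a b c d i j
  proof -
    have "(so32 a b ** so32 c d) $ i $ j
        = (\<Sum>k\<in>UNIV. (if k = b then \<delta> i a * eta b * so32 c d $ b $ j else 0)
            - (if k = a then \<delta> i b * eta a * so32 c d $ a $ j else 0))"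
      unfolding matrix_matrix_mult_def vec_lambda_beta
      by (rule sum.cong) (auto simp: entry[of a b] \<delta>_def)
    also have "\<dots> = \<delta> i a * (eta b * so32 c d $ b $ j) - \<delta> i b * (eta a * so32 c d $ a $ j)"
      by (simp add: sum_subtractf)
    finally show ?thesis
      by (simp add: entry[of c d] g(1)[symmetric] algebra_simps)
  qed
  show ?thesis
    unfolding vec_eq_iff
    by (intro allI) (simp add: mat_commutator_def prod entry g(2)[of d] g(2)[of c] algebra_simps)
qed

lemma in_so_iff: "A \<in> (so 3 2 :: (real^5^5) set) \<longleftrightarrow> (\<forall>i j. eta j * A $ j $ i = - (eta i * A $ i $ j))"
proof -
  have "(Gamma_mat 3 2 ** A) $ i $ j = eta i * A $ i $ j" for i j
    by (simp add: matrix_matrix_mult_def Gamma_mat_3_2 if_distrib[of "\<lambda>x. x * _"] cong: if_cong)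
  then show ?thesis
    unfolding so_def mem_Collect_eq vec_eq_iff transpose_def by simp
qed

lemma subspace_so: "subspace (so 3 2 :: (real^5^5) set)"
proof (rule subspaceI)
  fix c :: real and A B :: "real^5^5"
  show "0 \<in> (so 3 2 :: (real^5^5) set)" by (simp add: in_so_iff)
  assume A: "A \<in> so 3 2"
  have eq: "eta j * (c * A $ j $ i) = - (eta i * (c * A $ i $ j))" for i j
    using A[unfolded in_so_iff, rule_format, of j i]
    by (metis mult.left_commute mult_minus_right)
  show "c *\<^sub>R A \<in> so 3 2"
    unfolding in_so_iff vector_scaleR_component real_scaleR_def using eq by blast
  assume B: "B \<in> so 3 2"
  have eq: "eta j * (A + B) $ j $ i = - (eta i * (A + B) $ i $ j)" for i j
    using A[unfolded in_so_iff, rule_format, of j i] B[unfolded in_so_iff, rule_format, of j i]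
    unfolding vector_add_component distrib_left by linarith
  show "A + B \<in> so 3 2" unfolding in_so_iff using eq by blast
qed

text \<open>\<open>Gamma_mat\<close> times a generator is a skew matrix with the symmetric
  \<open>Gamma_mat\<close> on both sides, hence skew.\<close>

lemma so_gen_in_so: "so32 a b \<in> so 3 2"
  unfolding in_so_iff so_gen_entry conj_commute[of "_ = b"] by (intro allI) algebra

text \<open>Moving \<open>Gamma_mat\<close> past each transposed factor costs a sign, and the two
  signs cancel: the transpose of \<open>Gamma_mat 3 2 ** A ** B\<close> is
  \<open>Gamma_mat 3 2 ** B ** A\<close>, so the difference of the two is skew.\<close>

lemma mat_commutator_in_so:
  fixes A B :: "real^5^5"
  assumes "A \<in> so 3 2" "B \<in> so 3 2"
  shows "mat_commutator A B \<in> so 3 2"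
proof -
  have A: "eta i * A $ i $ j = - (eta j * A $ j $ i)" for i j
    using assms(1) unfolding in_so_iff by blast
  have B: "eta i * B $ i $ j = - (eta j * B $ j $ i)" for i j
    using assms(2) unfolding in_so_iff by blast
  have "eta i * (A ** B) $ i $ j = eta j * (B ** A) $ j $ i" for i j
    unfolding matrix_matrix_mult_def vec_lambda_beta sum_distrib_left
  proof (rule sum.cong)
    fix k
    have "eta i * (A $ i $ k * B $ k $ j) = - (A $ k $ i * (eta k * B $ k $ j))"
      using A[of i k] by (simp flip: mult.assoc)
    also have "\<dots> = eta j * (B $ j $ k * A $ k $ i)"
      using B[of k j] by simp
    finally show "eta i * (A $ i $ k * B $ k $ j) = eta j * (B $ j $ k * A $ k $ i)" .
  qed simp
  then show ?thesis
    unfolding in_so_iff mat_commutator_def by (simp add: right_diff_distrib)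
qed

text \<open>Summing over all ordered pairs counts each generator twice, hence the factor 1/2; this
  avoids any order on the cyclic index type. The weight \<open>eta b\<close> undoes the sign that
  \<open>Gamma_mat\<close> puts on column \<open>b\<close>.\<close>

lemma so_expansion:
  assumes "A \<in> so 3 2"
  shows "A = (1/2) *\<^sub>R (\<Sum>a\<in>UNIV. \<Sum>b\<in>UNIV. (A $ a $ b * eta b) *\<^sub>R so32 a b)"
proof -
  have "(\<Sum>a\<in>UNIV. \<Sum>b\<in>UNIV. A $ a $ b * eta b * so32 a b $ i $ j) = 2 * A $ i $ j" for i j
  proof -
    have "(\<Sum>a\<in>UNIV. \<Sum>b\<in>UNIV. A $ a $ b * eta b * so32 a b $ i $ j)
        = (\<Sum>a\<in>UNIV. \<Sum>b\<in>UNIV. (if b = j then if a = i then A $ i $ j else 0 else 0)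
            - (if b = i then if a = j then A $ j $ i * eta i * eta j else 0 else 0))"
      by (intro sum.cong) (auto simp: so_gen_entry)
    also have "\<dots> = A $ i $ j - eta j * A $ j $ i * eta i"
      by (simp add: sum_subtractf ac_simps)
    also have "eta j * A $ j $ i = - (eta i * A $ i $ j)"
      using assms unfolding in_so_iff by blast
    also have "A $ i $ j - - (eta i * A $ i $ j) * eta i = A $ i $ j + (eta i * eta i) * A $ i $ j"
      by (simp only: mult_minus_left diff_minus_eq_add mult_ac)
    also have "\<dots> = 2 * A $ i $ j" by simp
    finally show ?thesis .
  qed
  then show ?thesis unfolding vec_eq_iff by (simp add: sum_component)
qed

section \<open>The action on the null cone\<close>

text \<open>Cartesian coordinates are $x \pm iy = r \sin\theta\, e^{\pm i\varphi}$ and $z = r\cos\theta$.\<close>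

definition xi :: "5 \<Rightarrow> sfun" where
  "xi i = (vector
     [(1/2) *\<^sub>R (r_pow 1 * r_pow 1 + 1),
      (1/2) *\<^sub>R (r_pow 1 * sin_theta * (exp_i_phi (- 1) - exp_i_phi 1)),
      (1/2) *\<^sub>R (r_pow 1 * sin_theta * (exp_i_phi (- 1) + exp_i_phi 1)),
      r_pow 1 * cos_theta,
      (1/2) *\<^sub>R (r_pow 1 * r_pow 1 - 1)] :: sfun^5) $ i"

lemma xi_simps:
  "xi 1 = (1/2) *\<^sub>R (r_pow 1 * r_pow 1 + 1)"
  "xi 2 = (1/2) *\<^sub>R (r_pow 1 * sin_theta * (exp_i_phi (- 1) - exp_i_phi 1))"
  "xi 3 = (1/2) *\<^sub>R (r_pow 1 * sin_theta * (exp_i_phi (- 1) + exp_i_phi 1))"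
  "xi 4 = r_pow 1 * cos_theta"
  "xi 5 = (1/2) *\<^sub>R (r_pow 1 * r_pow 1 - 1)"
  unfolding xi_def by simp_all

text \<open>Column \<open>e\<close> of \<open>A\<close> holds the coordinates of the image of
  \<open>xi e\<close>, so that composing operators multiplies matrices in the same order.\<close>

definition act :: "real^5^5 \<Rightarrow> 5 \<Rightarrow> sfun" where
  "act A e = (\<Sum>f\<in>UNIV. A $ f $ e *\<^sub>R xi f)"

lemma linear_act: "linear (\<lambda>A. act A e)"
  unfolding act_def by (rule linearI) (simp_all add: algebra_simps sum.distrib scaleR_sum_right)

lemma act_so_gen:
  "act (so_gen 3 2 a b) e = (if e = b then eta b *\<^sub>R xi a else 0) - (if e = a then eta a *\<^sub>R xi b else 0)"
proof -
  have "act (so_gen 3 2 a b) e = (\<Sum>f\<in>UNIV. (if f = a then (if e = b then eta b *\<^sub>R xi a else 0) else 0)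
      - (if f = b then (if e = a then eta a *\<^sub>R xi b else 0) else 0))"
    unfolding act_def by (rule sum.cong) (auto simp: so_gen_entry)
  then show ?thesis by (simp add: sum_subtractf)
qed

text \<open>The graph of the isomorphism, kept as a relation: it is compatible with linear
  combinations and commutators, and each side determines the other. The hidden symbol
  \<open>v\<close> links the actual operator (\<open>k = 1\<close>) to its version on homogeneous
  functions of degree 1 (\<open>k = - 2\<close>).\<close>

definition induces :: "sop \<Rightarrow> real^5^5 \<Rightarrow> bool" where
  "induces X A \<longleftrightarrow> (\<exists>v. X = fop 1 v \<and> (\<forall>e. sop_apply (fop (- 2) v) (xi e) = act A e))"

lemma induces_add: "induces X A \<Longrightarrow> induces Y B \<Longrightarrow> induces (X + Y) (A + B)"
  unfolding induces_def
  by (metis linear_add[OF linear_fop] linear_add[OF linear_act] plus_sop.rep_eq)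

lemma induces_scaleR: "induces X A \<Longrightarrow> induces (s *\<^sub>R X) (s *\<^sub>R A)"
  unfolding induces_def
  by (metis linear_scale[OF linear_fop] linear_scale[OF linear_act] scaleR_sop.rep_eq)

lemma induces_uminus: "induces X A \<Longrightarrow> induces (- X) (- A)"
  using induces_scaleR[of X A "- 1"] by simp

lemma induces_diff: "induces X A \<Longrightarrow> induces Y B \<Longrightarrow> induces (X - Y) (A - B)"
  using induces_add[of X A "- Y" "- B"] induces_uminus[of Y B] by simp

lemma sop_apply_act:
  assumes "\<And>e. sop_apply X (xi e) = act A e"
  shows "sop_apply X (act B e) = act (A ** B) e"
proof -
  have "sop_apply X (act B e) = (\<Sum>f\<in>UNIV. \<Sum>g\<in>UNIV. (A $ g $ f * B $ f $ e) *\<^sub>R xi g)"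
    unfolding act_def[of B]
    by (simp add: linear_sum[OF linear_sop_apply] sop_apply_scaleR assms act_def scaleR_sum_right mult.commute)
  also have "\<dots> = act (A ** B) e"
    unfolding act_def matrix_matrix_mult_def
    by (subst sum.swap) (simp add: scaleR_sum_left)
  finally show ?thesis .
qed

text \<open>\<open>symbol_bracket v w\<close> is a symbol of the commutator for \<open>k = 1\<close>
  and for \<open>k = - 2\<close> alike, so it witnesses both halves of
  \<open>induces\<close>.\<close>

lemma induces_commutator:
  assumes "induces X A" "induces Y B"
  shows "induces (commutator X Y) (mat_commutator A B)"
proof -
  obtain v where v: "X = fop 1 v" "\<And>e. sop_apply (fop (- 2) v) (xi e) = act A e"
    using assms(1) by (auto simp: induces_def)
  obtain w where w: "Y = fop 1 w" "\<And>e. sop_apply (fop (- 2) w) (xi e) = act B e"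
    using assms(2) by (auto simp: induces_def)
  have "sop_apply (fop (- 2) (symbol_bracket v w)) (xi e) = act (mat_commutator A B) e" for e
    unfolding fop_symbol_bracket commutator_def mat_commutator_def linear_diff[OF linear_act]
    by (simp add: minus_sop.rep_eq times_sop.rep_eq v w sop_apply_act[OF v(2)] sop_apply_act[OF w(2)])
  then show ?thesis unfolding induces_def v w fop_symbol_bracket[symmetric] by blast
qed

section \<open>Operators and matrices determine each other\<close>

lemma sfun_cancel:
  assumes "f * g = 0" "\<And>r \<theta> \<phi>. (r, \<theta>, \<phi>) \<in> Omega \<Longrightarrow> sfun_apply g (r, \<theta>, \<phi>) \<noteq> 0"
  shows "f = 0"
proof (rule sfun_eq_on_OmegaI)
  fix r \<theta> \<phi> assume x: "(r, \<theta>, \<phi>) \<in> Omega"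
  have "sfun_apply f (r, \<theta>, \<phi>) * sfun_apply g (r, \<theta>, \<phi>) = 0"
    using arg_cong[OF assms(1), of "\<lambda>h. sfun_apply h (r, \<theta>, \<phi>)"] x by (simp add: sfun_apply_simps)
  then show "sfun_apply f (r, \<theta>, \<phi>) = sfun_apply 0 (r, \<theta>, \<phi>)"
    using assms(2)[OF x] by (simp add: sfun_apply_simps x)
qed

lemma Omega_nonzero:
  assumes "(r, \<theta>, \<phi>) \<in> Omega"
  shows "sin (complex_of_real \<theta>) \<noteq> 0" "r \<noteq> 0"
  using assms sin_gt_zero[of \<theta>] by (auto simp: Omega_def sin_of_real)

text \<open>Four test functions isolate the coefficients one after another: the constant 1 gives
  \<open>d\<close>, the square of r gives \<open>a\<close>, z gives \<open>b\<close>, and x + iy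
  gives \<open>c\<close>. All four are combinations of the \<open>xi e\<close>, and each remaining
  factor vanishes nowhere on \<open>Omega\<close>.\<close>

lemma fop_eq_0D:
  assumes "\<And>e. sop_apply (fop (- 2) v) (xi e) = 0"
  shows "v = 0"
proof -
  obtain a b c d where v: "v = (a, b, c, d)" by (cases v)
  note L = linear_add[OF linear_sop_apply] linear_diff[OF linear_sop_apply]
  have "sop_apply (fop (- 2) v) (xi 1 - xi 5) = 0" unfolding L assms by simp
  moreover have "xi 1 - xi 5 = 1"
    by (rule sfun_eq_on_OmegaI) (simp add: xi_simps sfun_eval_simps field_simps)
  ultimately have d: "d = 0" by (simp add: v fop_apply partial_simps)
  have "sop_apply (fop (- 2) v) (xi 1 + xi 5) = 0" unfolding L assms by simp
  moreover have "xi 1 + xi 5 = r_pow 1 * r_pow 1"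
    by (rule sfun_eq_on_OmegaI) (simp add: xi_simps sfun_eval_simps field_simps)
  ultimately have "a * (r_pow 1 + r_pow 1) = 0" by (simp add: v d fop_apply partial_simps)
  then have a: "a = 0" by (rule sfun_cancel) (auto simp: sfun_eval_simps Omega_nonzero)
  have "b * (r_pow 1 * sin_theta) = 0"
    using assms[of 4] by (simp add: v d a fop_apply partial_simps xi_simps)
  then have b: "b = 0" by (rule sfun_cancel) (simp add: sfun_apply_simps Omega_nonzero)
  have "sop_apply (fop (- 2) v) (xi 3 - xi 2) = 0" unfolding L assms by simp
  moreover have "xi 3 - xi 2 = r_pow 1 * sin_theta * exp_i_phi 1"
    by (rule sfun_eq_on_OmegaI) (simp add: xi_simps sfun_eval_simps field_simps)
  ultimately have "c * (r_pow 1 * sin_theta * (cconst \<i> * exp_i_phi 1)) = 0"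
    by (simp add: v d a b fop_apply partial_simps)
  then have c: "c = 0" by (rule sfun_cancel) (simp add: sfun_apply_simps Omega_nonzero)
  show ?thesis by (simp add: v a b c d zero_prod_def)
qed

lemma induces_unique_left:
  assumes "induces X A" "induces Y A"
  shows "X = Y"
proof -
  obtain v where v: "X - Y = fop 1 v" "\<And>e. sop_apply (fop (- 2) v) (xi e) = act (A - A) e"
    using induces_diff[OF assms] unfolding induces_def by blast
  have "v = 0" by (rule fop_eq_0D) (simp add: v linear_0[OF linear_act])
  then show ?thesis using v(1) linear_0[OF linear_fop] by simp
qed

text \<open>Applying the operator to the constant 1 shows \<open>d = 0\<close>, after which the
  factor \<open>k\<close> makes no difference and \<open>fop_eq_0D\<close> applies.\<close>

lemma fop_1_eq_0D:
  assumes "fop 1 v = 0"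
  shows "v = 0"
proof -
  obtain a b c d where v: "v = (a, b, c, d)" by (cases v)
  have "sop_apply (fop 1 v) 1 = 0" using assms by (simp add: zero_sop.rep_eq)
  then have "d = 0" by (simp add: v fop_apply partial_1)
  then have "fop (- 2) v = fop 1 v" by (simp add: v fop_def)
  then show ?thesis using assms by (intro fop_eq_0D) (simp add: zero_sop.rep_eq)
qed

text \<open>Evaluation at a few points suffices. At \<open>r = 1\<close> the function
  \<open>xi 5\<close> vanishes and at \<open>\<theta> = pi/2\<close> so does \<open>xi 4\<close>;
  the imaginary part isolates \<open>xi 2\<close>. The points with \<open>r = 2\<close> and with
  \<open>\<theta> = pi/3\<close> then settle \<open>s 5\<close> and \<open>s 4\<close>.\<close>

lemma xi_independent:
  assumes "(\<Sum>f\<in>UNIV. s f *\<^sub>R xi f) = 0"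
  shows "s f = 0"
proof -
  have ev: "of_real (s 1 * (r * r + 1) / 2) - \<i> * of_real (s 2 * r * sin \<theta> * sin \<phi>)
     + of_real (s 3 * r * sin \<theta> * cos \<phi> + s 4 * r * cos \<theta> + s 5 * (r * r - 1) / 2) = 0"
    if x: "(r, \<theta>, \<phi>) \<in> Omega" for r \<theta> \<phi>
  proof -
    have E: "exp (\<i> * complex_of_real \<phi>) = of_real (cos \<phi>) + \<i> * of_real (sin \<phi>)"
      "exp (- (\<i> * complex_of_real \<phi>)) = of_real (cos \<phi>) - \<i> * of_real (sin \<phi>)"
      using exp_Euler[of "of_real \<phi>"] exp_minus_Euler[of "of_real \<phi>"] by (simp_all add: sin_of_real cos_of_real)
    have "sfun_apply (\<Sum>f\<in>UNIV. s f *\<^sub>R xi f) (r, \<theta>, \<phi>)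
        = of_real (s 1 * (r * r + 1) / 2) - \<i> * of_real (s 2 * r * sin \<theta> * sin \<phi>)
          + of_real (s 3 * r * sin \<theta> * cos \<phi> + s 4 * r * cos \<theta> + s 5 * (r * r - 1) / 2)"
      by (simp add: sum_5 xi_simps sfun_apply_simps x E sin_of_real cos_of_real field_simps)
    then show ?thesis using assms x by (simp add: sfun_apply_simps)
  qed
  have Om: "(r, pi/2, \<phi>) \<in> Omega" "(r, pi/3, \<phi>) \<in> Omega" if "r > 0" for r \<phi>
    using that by (auto simp: Omega_def)
  have "s 1 + s 3 = 0" using ev[OF Om(1)[of 1 0]] by (simp add: complex_eq_iff)
  moreover have "s 1 - s 3 = 0" using ev[OF Om(1)[of 1 pi]] by (simp add: complex_eq_iff)
  moreover have "s 2 = 0" using ev[OF Om(1)[of 1 "pi/2"]] by (simp add: complex_eq_iff)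
  moreover have "s 1 * 5 / 2 + s 3 * 2 + s 5 * 3 / 2 = 0" using ev[OF Om(1)[of 2 0]] by (simp add: complex_eq_iff)
  moreover have "s 1 + s 3 * sin (pi/3) + s 4 / 2 = 0" using ev[OF Om(2)[of 1 0]] by (simp add: complex_eq_iff cos_60)
  ultimately have "s 1 = 0" "s 2 = 0" "s 3 = 0" "s 4 = 0" "s 5 = 0" by auto
  then show ?thesis using exhaust_5[of f] by auto
qed

lemma induces_unique_right:
  assumes "induces X A" "induces X B"
  shows "A = B"
proof -
  have "induces 0 (A - B)" using induces_diff[OF assms] by simp
  then obtain v where "fop 1 v = 0" and v: "\<And>e. sop_apply (fop (- 2) v) (xi e) = act (A - B) e"
    unfolding induces_def by metis
  then have "v = 0" by (intro fop_1_eq_0D)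
  then have "act (A - B) e = 0" for e
    using v[of e] linear_0[OF linear_fop, of "- 2"] by (simp add: zero_sop.rep_eq)
  then have "(A - B) $ i $ j = 0" for i j
    using xi_independent[of "\<lambda>i. (A - B) $ i $ j" i] by (simp add: act_def)
  then show ?thesis by (simp add: vec_eq_iff)
qed

section \<open>Matrices of the explicit operators\<close>

lemma inducesI:
  assumes "\<And>f r \<theta> \<phi>. (r, \<theta>, \<phi>) \<in> Omega \<Longrightarrow>
      sfun_apply (sop_apply Y f) (r, \<theta>, \<phi>) = sfun_apply (sop_apply (fop 1 v) f) (r, \<theta>, \<phi>)"
    and "\<And>e r \<theta> \<phi>. (r, \<theta>, \<phi>) \<in> Omega \<Longrightarrow>
      sfun_apply (sop_apply (fop (- 2) v) (xi e)) (r, \<theta>, \<phi>) = sfun_apply (act A e) (r, \<theta>, \<phi>)"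
  shows "induces Y A"
  unfolding induces_def using assms by (blast intro: sop_eqI sfun_eq_on_OmegaI)

lemmas act_simps = linear_add[OF linear_act] linear_diff[OF linear_act] linear_neg[OF linear_act]
  linear_scale[OF linear_act] act_so_gen

text \<open>The versions with a trailing factor \<open>y\<close>, here and in
  \<open>sin_times_sin\<close>, let the identities rewrite inside right-nested products.\<close>

lemma exp_cancel:
  "exp z * exp (- z) = 1" "exp z * (exp (- z) * y) = y" for z y :: complex
  by (simp_all flip: exp_add mult.assoc)

lemma sin_times_sin:
  "sin z * sin z = 1 - cos z * cos z" "sin z * (sin z * y) = y - cos z * (cos z * y)" for z y :: complex
proof -
  show *: "sin z * sin z = 1 - cos z * cos z"
    using sin_squared_eq[of z] by (simp add: power2_eq_square)
  show "sin z * (sin z * y) = y - cos z * (cos z * y)"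
    unfolding mult.assoc[symmetric] * by (simp add: left_diff_distrib)
qed

text \<open>The matrix is read off the array: \<open>J_pm e\<close> equals
  \<open>cart1 J_triple\<close> plus \<open>e\<close> times \<open>cart2 J_triple\<close>, which are
  minus the entry (2,4) and the entry (3,4). The symbol \<open>v\<close> is the expanded
  operator.\<close>

lemma induces_J_pm:
  assumes e: "e = 1 \<or> e = - 1"
  shows "induces (J_pm e) (of_int e *\<^sub>R so32 3 4 - so32 2 4)"
proof -
  define v :: symbol where "v = (0, of_int e * exp_i_phi e, cconst \<i> * cot_theta * exp_i_phi e, 0)"
  show ?thesis
  proof (rule inducesI[where v = v])
    fix f r \<theta> \<phi> and i :: 5 assume x: "(r, \<theta>, \<phi>) \<in> Omega"
    show "sfun_apply (sop_apply (J_pm e) f) (r, \<theta>, \<phi>) = sfun_apply (sop_apply (fop 1 v) f) (r, \<theta>, \<phi>)"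
      using e by (auto simp: v_def J_pm_def sop_apply_simps fop_apply sfun_eval_simps x algebra_simps)
    show "sfun_apply (sop_apply (fop (- 2) v) (xi i)) (r, \<theta>, \<phi>) = sfun_apply (act (of_int e *\<^sub>R so32 3 4 - so32 2 4) i) (r, \<theta>, \<phi>)"
      \<comment> \<open>Where r and \<open>sin \<theta>\<close> are nonzero the denominators can be
        cleared, leaving a polynomial identity in sines, cosines and exponentials.\<close>
      using e exhaust_5[of i] Omega_nonzero[OF x]
      by (auto simp: v_def act_simps xi_simps fop_apply partial_simps sfun_eval_simps x field_simps;
          simp add: algebra_simps exp_cancel sin_times_sin)
  qed
qed

text \<open>Entry (1,4) of the array is half of \<open>K_pm 1 - K_pm (-1)\<close> and entry (4,5) is
  minus half of the sum; solving for \<open>K_pm e\<close> gives the matrix.\<close>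

lemma induces_K_pm:
  assumes e: "e = 1 \<or> e = - 1"
  shows "induces (K_pm e) (of_int e *\<^sub>R so32 1 4 - so32 4 5)"
proof -
  define v :: symbol where "v = (r_pow e * cos_theta * r_pow 1, of_int e * r_pow e * sin_theta, 0,
    ((1 + of_int e) / 2) *\<^sub>R (r_pow e * cos_theta))"
  show ?thesis
  proof (rule inducesI[where v = v])
    fix f r \<theta> \<phi> and i :: 5 assume x: "(r, \<theta>, \<phi>) \<in> Omega"
    show "sfun_apply (sop_apply (K_pm e) f) (r, \<theta>, \<phi>) = sfun_apply (sop_apply (fop 1 v) f) (r, \<theta>, \<phi>)"
      using e by (auto simp: v_def K_pm_def sop_apply_simps fop_apply sfun_eval_simps x algebra_simps)
    show "sfun_apply (sop_apply (fop (- 2) v) (xi i)) (r, \<theta>, \<phi>) = sfun_apply (act (of_int e *\<^sub>R so32 1 4 - so32 4 5) i) (r, \<theta>, \<phi>)"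
      using e exhaust_5[of i] Omega_nonzero[OF x]
      by (auto simp: v_def act_simps xi_simps fop_apply partial_simps sfun_eval_simps x field_simps;
          simp add: algebra_simps exp_cancel sin_times_sin)
  qed
qed

text \<open>\<open>R_pm 1\<close> is minus the plus component of \<open>C_triple\<close>, which is
  \<open>PCp_triple - PCm_triple\<close>; \<open>R_pm (-1)\<close> is minus the minus component of
  \<open>P_triple\<close>, which is \<open>PCp_triple + PCm_triple\<close>. Passing to Cartesian
  components and then to array entries gives the four terms.\<close>

lemma induces_R_pm:
  assumes e: "e = 1 \<or> e = - 1"
  shows "induces (R_pm e) (so32 3 5 - of_int e *\<^sub>R so32 1 3 - of_int e *\<^sub>R so32 2 5 + so32 1 2)"
proof -
  define v :: symbol where "v = (- (r_pow e * exp_i_phi e * sin_theta * r_pow 1), of_int e * r_pow e * exp_i_phi e * cos_theta,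
    cconst \<i> * csc_theta * r_pow e * exp_i_phi e, - ((1 + of_int e) / 2) *\<^sub>R (r_pow e * exp_i_phi e * sin_theta))"
  show ?thesis
  proof (rule inducesI[where v = v])
    fix f r \<theta> \<phi> and i :: 5 assume x: "(r, \<theta>, \<phi>) \<in> Omega"
    show "sfun_apply (sop_apply (R_pm e) f) (r, \<theta>, \<phi>) = sfun_apply (sop_apply (fop 1 v) f) (r, \<theta>, \<phi>)"
      using e by (auto simp: v_def R_pm_def sop_apply_simps fop_apply sfun_eval_simps x algebra_simps)
    show "sfun_apply (sop_apply (fop (- 2) v) (xi i)) (r, \<theta>, \<phi>) = sfun_apply (act (so32 3 5 - of_int e *\<^sub>R so32 1 3 - of_int e *\<^sub>R so32 2 5 + so32 1 2) i) (r, \<theta>, \<phi>)"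
      using e exhaust_5[of i] Omega_nonzero[OF x]
      by (auto simp: v_def act_simps xi_simps fop_apply partial_simps sfun_eval_simps x field_simps;
          simp add: algebra_simps exp_cancel sin_times_sin)
  qed
qed

text \<open>As for \<open>R_pm\<close>, now with \<open>S_pm (-1)\<close> the plus component of
  \<open>P_triple\<close> and \<open>S_pm 1\<close> the minus component of
  \<open>C_triple\<close>.\<close>

lemma induces_S_pm:
  assumes e: "e = 1 \<or> e = - 1"
  shows "induces (S_pm e) (- so32 3 5 + of_int e *\<^sub>R so32 1 3 - of_int e *\<^sub>R so32 2 5 + so32 1 2)"
proof -
  define v :: symbol where "v = (r_pow e * exp_i_phi (- e) * sin_theta * r_pow 1, - of_int e * r_pow e * exp_i_phi (- e) * cos_theta,
    cconst \<i> * csc_theta * r_pow e * exp_i_phi (- e), ((1 + of_int e) / 2) *\<^sub>R (r_pow e * exp_i_phi (- e) * sin_theta))"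
  show ?thesis
  proof (rule inducesI[where v = v])
    fix f r \<theta> \<phi> and i :: 5 assume x: "(r, \<theta>, \<phi>) \<in> Omega"
    show "sfun_apply (sop_apply (S_pm e) f) (r, \<theta>, \<phi>) = sfun_apply (sop_apply (fop 1 v) f) (r, \<theta>, \<phi>)"
      using e by (auto simp: v_def S_pm_def sop_apply_simps fop_apply sfun_eval_simps x algebra_simps)
    show "sfun_apply (sop_apply (fop (- 2) v) (xi i)) (r, \<theta>, \<phi>) = sfun_apply (act (- so32 3 5 + of_int e *\<^sub>R so32 1 3 - of_int e *\<^sub>R so32 2 5 + so32 1 2) i) (r, \<theta>, \<phi>)"
      using e exhaust_5[of i] Omega_nonzero[OF x]
      by (auto simp: v_def act_simps xi_simps fop_apply partial_simps sfun_eval_simps x field_simps;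
          simp add: algebra_simps exp_cancel sin_times_sin)
  qed
qed

text \<open>Because \<open>xi 2\<close> is -iy, the imaginary factor of \<open>J_3\<close> is
  absorbed: \<open>xi 2\<close> and \<open>xi 3\<close> are exchanged up to sign, with real
  coefficients.\<close>

lemma induces_J_3:
  shows "induces J_3 (so32 2 3)"
proof -
  define v :: symbol where "v = (0, 0, - cconst \<i>, 0)"
  show ?thesis
  proof (rule inducesI[where v = v])
    fix f r \<theta> \<phi> and i :: 5 assume x: "(r, \<theta>, \<phi>) \<in> Omega"
    show "sfun_apply (sop_apply J_3 f) (r, \<theta>, \<phi>) = sfun_apply (sop_apply (fop 1 v) f) (r, \<theta>, \<phi>)"
      by (auto simp: v_def J_3_def sop_apply_simps fop_apply sfun_eval_simps x algebra_simps)
    show "sfun_apply (sop_apply (fop (- 2) v) (xi i)) (r, \<theta>, \<phi>) = sfun_apply (act (so32 2 3) i) (r, \<theta>, \<phi>)"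
      using exhaust_5[of i] Omega_nonzero[OF x]
      by (auto simp: v_def act_simps xi_simps fop_apply partial_simps sfun_eval_simps x field_simps;
          simp add: algebra_simps exp_cancel sin_times_sin)
  qed
qed

text \<open>The factor -2 turns the term 1/2 into -1, and \<open>r D_r - 1\<close> annihilates
  \<open>xi 2\<close>, \<open>xi 3\<close>, \<open>xi 4\<close> and exchanges \<open>xi 1\<close>
  with \<open>xi 5\<close>.\<close>

lemma induces_K_3:
  shows "induces K_3 (- so32 1 5)"
proof -
  define v :: symbol where "v = (r_pow 1, 0, 0, (1/2) *\<^sub>R 1)"
  show ?thesis
  proof (rule inducesI[where v = v])
    fix f r \<theta> \<phi> and i :: 5 assume x: "(r, \<theta>, \<phi>) \<in> Omega"
    show "sfun_apply (sop_apply K_3 f) (r, \<theta>, \<phi>) = sfun_apply (sop_apply (fop 1 v) f) (r, \<theta>, \<phi>)"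
      by (auto simp: v_def K_3_def sop_apply_simps fop_apply sfun_eval_simps x algebra_simps)
    show "sfun_apply (sop_apply (fop (- 2) v) (xi i)) (r, \<theta>, \<phi>) = sfun_apply (act (- so32 1 5) i) (r, \<theta>, \<phi>)"
      using exhaust_5[of i] Omega_nonzero[OF x]
      by (auto simp: v_def act_simps xi_simps fop_apply partial_simps sfun_eval_simps x field_simps;
          simp add: algebra_simps exp_cancel sin_times_sin)
  qed
qed

section \<open>The array as an isomorphic image of the standard basis\<close>

abbreviation M :: "5 \<Rightarrow> 5 \<Rightarrow> sop" where "M a b \<equiv> M_array $ a $ b"

lemma induces_0: "induces 0 0"
  unfolding induces_def
  by (rule exI[of _ 0]) (simp add: linear_0[OF linear_fop] linear_0[OF linear_act] zero_sop.rep_eq)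

lemma induces_M_upper:
  "induces (M 1 2) (so32 1 2)" "induces (M 1 3) (so32 1 3)" "induces (M 1 4) (so32 1 4)" "induces (M 1 5) (so32 1 5)"
  "induces (M 2 3) (so32 2 3)" "induces (M 2 4) (so32 2 4)" "induces (M 2 5) (so32 2 5)"
  "induces (M 3 4) (so32 3 4)" "induces (M 3 5) (so32 3 5)" "induces (M 4 5) (so32 4 5)"
proof -
  note base = induces_J_pm[of 1] induces_J_pm[of "- 1"] induces_K_pm[of 1] induces_K_pm[of "- 1"]
    induces_R_pm[of 1] induces_R_pm[of "- 1"] induces_S_pm[of 1] induces_S_pm[of "- 1"]
    induces_J_3 induces_K_3
  note intros = induces_add induces_diff induces_uminus induces_scaleR base[simplified]
  note unf = M_array_def Let_def J_triple_def PCp_triple_def PCm_triple_def P_triple_def C_triple_def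
    vector_5 cart1.simps cart2.simps cart3.simps add_Pair diff_Pair scaleR_Pair
  \<comment> \<open>The shape of the operator dictates the matrix \<open>B\<close> assembled by the
    introduction rules; only afterwards is it compared entrywise with \<open>A\<close>.\<close>
  have *: "induces Y A" if "induces Y B" "\<And>i j. A $ i $ j = B $ i $ j" for Y A B
    using that by (metis vec_eq_iff)
  show "induces (M 1 2) (so32 1 2)" "induces (M 1 3) (so32 1 3)" "induces (M 1 4) (so32 1 4)" "induces (M 1 5) (so32 1 5)"
    "induces (M 2 3) (so32 2 3)" "induces (M 2 4) (so32 2 4)" "induces (M 2 5) (so32 2 5)"
    "induces (M 3 4) (so32 3 4)" "induces (M 3 5) (so32 3 5)" "induces (M 4 5) (so32 4 5)"
    unfolding unf by (rule *, (rule intros)+, simp add: field_simps)+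
qed

lemma M_array_same: "M a a = 0"
  and M_array_swap: "M b a = - M a b"
proof -
  have "M i i = 0 \<and> M j i = - M i j" for i j
    using exhaust_5[of i] exhaust_5[of j] by (elim disjE; simp add: M_array_def Let_def)
  then show "M a a = 0" "M b a = - M a b" by blast+
qed

lemma induces_M: "induces (M a b) (so32 a b)"
proof -
  have swap: "induces (M j i) (so32 j i)" if "induces (M i j) (so32 i j)" for i j
    unfolding M_array_swap[of j i] so_gen_swap[of j i] using that by (rule induces_uminus)
  have diag: "induces (M i i) (so32 i i)" for i
    unfolding M_array_same so_gen_same by (rule induces_0)
  show ?thesis
    using exhaust_5[of a] exhaust_5[of b]
    by (elim disjE; hypsubst; intro diag induces_M_upper induces_M_upper[THEN swap])
qed

text \<open>Both sides induce the same matrix by \<open>mat_commutator_so_gen\<close>, so no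
  commutator of the operators has to be expanded.\<close>

lemma M_array_commutator:
  fixes a b c d :: 5
  defines "g \<equiv> \<lambda>i j. (Gamma_mat 3 2 :: real^5^5) $ i $ j"
  shows "commutator (M a b) (M c d)
    = g a d *\<^sub>R M b c + g b c *\<^sub>R M a d - g a c *\<^sub>R M b d - g b d *\<^sub>R M a c"
proof (rule induces_unique_left)
  show "induces (commutator (M a b) (M c d))
      (g a d *\<^sub>R so32 b c + g b c *\<^sub>R so32 a d - g a c *\<^sub>R so32 b d - g b d *\<^sub>R so32 a c)"
    using induces_commutator[OF induces_M induces_M] by (simp add: mat_commutator_so_gen g_def)
qed (intro induces_add induces_diff induces_scaleR induces_M)

section \<open>The Lie algebra of operators induced by matrices\<close>

text \<open>The domain of the isomorphism, which serves as a bridge: it turns out to be both the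
  span of the array and \<open>generated_alg\<close>.\<close>

definition so_ops :: "sop set" where
  "so_ops = {Y. \<exists>A\<in>so 3 2. induces Y A}"

lemma induces_sum: "(\<And>i. i \<in> I \<Longrightarrow> induces (f i) (h i)) \<Longrightarrow> induces (sum f I) (sum h I)"
  by (induction I rule: infinite_finite_induct) (auto intro: induces_add induces_0)

lemma induces_expansion:
  assumes "A \<in> so 3 2"
  shows "induces ((1/2) *\<^sub>R (\<Sum>a\<in>UNIV. \<Sum>b\<in>UNIV. (A $ a $ b * eta b) *\<^sub>R M a b)) A"
proof -
  have "induces ((1/2) *\<^sub>R (\<Sum>a\<in>UNIV. \<Sum>b\<in>UNIV. (A $ a $ b * eta b) *\<^sub>R M a b))
      ((1/2) *\<^sub>R (\<Sum>a\<in>UNIV. \<Sum>b\<in>UNIV. (A $ a $ b * eta b) *\<^sub>R so32 a b))"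
    by (intro induces_scaleR induces_sum induces_M)
  then show ?thesis unfolding so_expansion[OF assms, symmetric] .
qed

lemma so_ops_lie_subalgebra: "lie_subalgebra commutator so_ops"
  unfolding lie_subalgebra_def
proof (intro conjI ballI subspaceI)
  show "0 \<in> so_ops" unfolding so_ops_def using subspace_0[OF subspace_so] induces_0 by blast
  fix x y assume "x \<in> so_ops" "y \<in> so_ops"
  then obtain A B where A: "A \<in> so 3 2" "induces x A" and B: "B \<in> so 3 2" "induces y B"
    unfolding so_ops_def by blast
  show "x + y \<in> so_ops"
    unfolding so_ops_def using subspace_add[OF subspace_so A(1) B(1)] induces_add[OF A(2) B(2)] by blast
  show "commutator x y \<in> so_ops"
    unfolding so_ops_def using mat_commutator_in_so[OF A(1) B(1)] induces_commutator[OF A(2) B(2)] by blast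
next
  fix c x assume "x \<in> so_ops"
  then obtain A where A: "A \<in> so 3 2" "induces x A" unfolding so_ops_def by blast
  show "c *\<^sub>R x \<in> so_ops"
    unfolding so_ops_def using subspace_scale[OF subspace_so A(1)] induces_scaleR[OF A(2)] by blast
qed

text \<open>An operator inducing \<open>A\<close> must coincide with the expansion of
  \<open>A\<close> carried over to the array, since matrices determine operators.\<close>

lemma so_ops_subset:
  assumes "subspace H" "\<And>a b. M a b \<in> H"
  shows "so_ops \<subseteq> H"
proof
  fix Y assume "Y \<in> so_ops"
  then obtain A where A: "A \<in> so 3 2" "induces Y A" unfolding so_ops_def by blast
  then have "Y = (1/2) *\<^sub>R (\<Sum>a\<in>UNIV. \<Sum>b\<in>UNIV. (A $ a $ b * eta b) *\<^sub>R M a b)"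
    by (intro induces_unique_left[OF A(2)] induces_expansion A(1))
  also have "\<dots> \<in> H"
    using assms by (intro subspace_scale subspace_sum) auto
  finally show "Y \<in> H" .
qed

lemma M_array_in_so_ops: "M a b \<in> so_ops"
  unfolding so_ops_def using so_gen_in_so induces_M by blast

section \<open>The ten entries above the diagonal as a basis\<close>

abbreviation upper :: "(nat \<times> nat) set" where
  "upper \<equiv> {(a, b). 1 \<le> a \<and> a < b \<and> b \<le> 5}"

lemma of_nat_5_inject:
  assumes "1 \<le> a" "a \<le> 5" "1 \<le> b" "b \<le> 5" "(of_nat a :: 5) = of_nat b"
  shows "a = b"
proof -
  have "a = 1 \<or> a = 2 \<or> a = 3 \<or> a = 4 \<or> a = 5" "b = 1 \<or> b = 2 \<or> b = 3 \<or> b = 4 \<or> b = 5"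
    using assms by auto
  then show ?thesis using assms(5) by (elim disjE) simp_all
qed

text \<open>The second matrix unit of a generator lies below the diagonal, so the entry at an upper
  position extracts one coefficient, up to the sign \<open>eta\<close>.\<close>

lemma so_gen_entry_upper:
  assumes "(a, b) \<in> upper" "(c, d) \<in> upper"
  shows "so32 (of_nat a) (of_nat b) $ of_nat c $ of_nat d = (if (a, b) = (c, d) then eta (of_nat d) else 0)"
proof -
  have "of_nat c = (of_nat a :: 5) \<longleftrightarrow> c = a" "of_nat d = (of_nat b :: 5) \<longleftrightarrow> d = b"
    "of_nat c = (of_nat b :: 5) \<longleftrightarrow> c = b" "of_nat d = (of_nat a :: 5) \<longleftrightarrow> d = a"
    using assms by (auto dest!: of_nat_5_inject[rotated -1])
  then show ?thesis unfolding so_gen_entry using assms by auto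
qed

lemma inj_on_M_array: "inj_on (\<lambda>(a, b). M (of_nat a) (of_nat b)) upper"
proof (rule inj_onI, clarify)
  fix a b c d :: nat
  assume ab: "1 \<le> a" "a < b" "b \<le> 5" and cd: "1 \<le> c" "c < d" "d \<le> 5"
    and eq: "M (of_nat a) (of_nat b) = M (of_nat c) (of_nat d)"
  have "so32 (of_nat a) (of_nat b) = so32 (of_nat c) (of_nat d)"
    using induces_M[of "of_nat a" "of_nat b"] induces_M[of "of_nat c" "of_nat d"] eq
    by (metis induces_unique_right)
  then have "so32 (of_nat a) (of_nat b) $ of_nat c $ of_nat d = so32 (of_nat c) (of_nat d) $ of_nat c $ of_nat d"
    by (rule arg_cong)
  moreover have "eta (of_nat d) \<noteq> 0" by (metis eta_square mult_zero_left zero_neq_one)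
  ultimately show "a = c \<and> b = d"
    using so_gen_entry_upper[of a b c d] so_gen_entry_upper[of c d c d] ab cd by (auto split: if_splits)
qed

lemma finite_upper: "finite upper"
  by (rule finite_subset[of _ "{..5} \<times> {..5}"]) auto

lemma independent_M_array: "independent ((\<lambda>(a, b). M (of_nat a) (of_nat b)) ` upper)"
proof (rule independent_if_scalars_zero)
  show "finite ((\<lambda>(a, b). M (of_nat a) (of_nat b)) ` upper)" using finite_upper by (rule finite_imageI)
  fix f Y
  assume sum0: "(\<Sum>Y\<in>(\<lambda>(a, b). M (of_nat a) (of_nat b)) ` upper. f Y *\<^sub>R Y) = 0"
    and "Y \<in> (\<lambda>(a, b). M (of_nat a) (of_nat b)) ` upper"
  then obtain c d where cd: "(c, d) \<in> upper" and Y: "Y = M (of_nat c) (of_nat d)" by auto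
  \<comment> \<open>Coefficients indexed by pairs instead of by operators;
    \<open>inj_on_M_array\<close> justifies the reindexing.\<close>
  define s where "s = (\<lambda>p. f (case p of (a, b) \<Rightarrow> M (of_nat a) (of_nat b)))"
  have "(\<Sum>p\<in>upper. s p *\<^sub>R (case p of (a, b) \<Rightarrow> M (of_nat a) (of_nat b))) = 0"
    using sum0 unfolding sum.reindex[OF inj_on_M_array] by (simp add: s_def o_def)
  moreover have "induces (\<Sum>p\<in>upper. s p *\<^sub>R (case p of (a, b) \<Rightarrow> M (of_nat a) (of_nat b)))
      (\<Sum>p\<in>upper. s p *\<^sub>R (case p of (a, b) \<Rightarrow> so32 (of_nat a) (of_nat b)))"
    by (intro induces_sum induces_scaleR) (auto intro: induces_M)
  \<comment> \<open>The operator 0 induces only the zero matrix, so the relation passes to the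
    generators, where the entry at \<open>(c, d)\<close> isolates \<open>s (c, d)\<close>.\<close>
  ultimately have "(\<Sum>p\<in>upper. s p *\<^sub>R (case p of (a, b) \<Rightarrow> so32 (of_nat a) (of_nat b))) = 0"
    by (simp only: induces_unique_right[OF _ induces_0])
  then have "0 = (\<Sum>p\<in>upper. s p *\<^sub>R (case p of (a, b) \<Rightarrow> so32 (of_nat a) (of_nat b))) $ of_nat c $ of_nat d"
    by simp
  also have "\<dots> = (\<Sum>p\<in>upper. if p = (c, d) then s (c, d) * eta (of_nat d) else 0)"
    unfolding sum_component vector_scaleR_component real_scaleR_def
  proof (rule sum.cong[OF refl])
    fix p assume p: "p \<in> upper"
    obtain a b where ab: "p = (a, b)" by (cases p)
    show "s p * (case p of (a, b) \<Rightarrow> so32 (of_nat a) (of_nat b)) $ of_nat c $ of_nat d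
        = (if p = (c, d) then s (c, d) * eta (of_nat d) else 0)"
      using so_gen_entry_upper[OF p[unfolded ab] cd] by (simp add: ab)
  qed
  also have "\<dots> = s (c, d) * eta (of_nat d)"
    using finite_upper cd by (simp add: sum.delta)
  finally have "s (c, d) = 0" by (metis eta_square mult_eq_0_iff zero_neq_one)
  then show "f Y = 0" by (simp add: s_def Y)
qed

lemma image_upper: "{M (of_nat a) (of_nat b) | a b :: nat. 1 \<le> a \<and> a < b \<and> b \<le> 5}
    = (\<lambda>(a, b). M (of_nat a) (of_nat b)) ` upper"
  by auto

lemma span_M_array: "span ((\<lambda>(a, b). M (of_nat a) (of_nat b)) ` upper) = so_ops" (is "span ?S = _")
proof
  show "span ?S \<subseteq> so_ops"
    using so_ops_lie_subalgebra M_array_in_so_ops by (intro span_minimal) (auto simp: lie_subalgebra_def)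
  have up: "M (of_nat a) (of_nat b) \<in> span ?S" if "1 \<le> a" "a < b" "b \<le> 5" for a b :: nat
    using that by (intro span_base) auto
  have up': "M 1 2 \<in> span ?S" "M 1 3 \<in> span ?S" "M 1 4 \<in> span ?S" "M 1 5 \<in> span ?S" "M 2 3 \<in> span ?S"
    "M 2 4 \<in> span ?S" "M 2 5 \<in> span ?S" "M 3 4 \<in> span ?S" "M 3 5 \<in> span ?S" "M 4 5 \<in> span ?S"
    using up[of 1 2] up[of 1 3] up[of 1 4] up[of 1 5] up[of 2 3] up[of 2 4] up[of 2 5] up[of 3 4] up[of 3 5] up[of 4 5]
    by (simp_all only: of_nat_1 of_nat_numeral)
  have swap: "M j i \<in> span ?S" if "M i j \<in> span ?S" for i j
    unfolding M_array_swap[of j i] using that by (rule span_neg)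
  have diag: "M i i \<in> span ?S" for i
    unfolding M_array_same by (rule span_zero)
  have "M a b \<in> span ?S" for a b
    using exhaust_5[of a] exhaust_5[of b]
    by (elim disjE; hypsubst; intro diag up' up'[THEN swap])
  then show "so_ops \<subseteq> span ?S" by (intro so_ops_subset subspace_span)
qed

section \<open>Generation and the isomorphism\<close>

lemma generated_alg_eq_so_ops: "generated_alg = so_ops"
proof
  have mem: "A \<in> so 3 2 \<Longrightarrow> induces Y A \<Longrightarrow> Y \<in> so_ops" for A Y
    unfolding so_ops_def by blast
  note S = subspace_add[OF subspace_so] subspace_diff[OF subspace_so] subspace_scale[OF subspace_so] so_gen_in_so
  show "generated_alg \<subseteq> so_ops"
    unfolding generated_alg_def
  proof (rule hull_minimal)
    show "lie_subalgebra commutator so_ops" by (rule so_ops_lie_subalgebra)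
    have "J_pm e \<in> so_ops" "K_pm e \<in> so_ops" if "e = 1 \<or> e = - 1" for e
      by (rule mem[OF _ induces_J_pm[OF that]] mem[OF _ induces_K_pm[OF that]]; intro S)+
    then show "{J_pm 1, J_pm (- 1), K_pm 1, K_pm (- 1)} \<subseteq> so_ops" by simp
  qed
  have sub: "subspace generated_alg"
    and br: "\<And>x y. x \<in> generated_alg \<Longrightarrow> y \<in> generated_alg \<Longrightarrow> commutator x y \<in> generated_alg"
  proof -
    have "lie_subalgebra commutator generated_alg"
      unfolding generated_alg_def
      by (rule hull_in) (auto simp: lie_subalgebra_def intro: subspace_Inter)
    then show "subspace generated_alg"
      "\<And>x y. x \<in> generated_alg \<Longrightarrow> y \<in> generated_alg \<Longrightarrow> commutator x y \<in> generated_alg"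
      by (auto simp: lie_subalgebra_def)
  qed
  have gens: "J_pm 1 \<in> generated_alg" "J_pm (- 1) \<in> generated_alg" "K_pm 1 \<in> generated_alg" "K_pm (- 1) \<in> generated_alg"
    unfolding generated_alg_def by (simp_all add: hull_inc)
  note ind = induces_J_pm[of 1, simplified] induces_J_pm[of "- 1", simplified]
    induces_K_pm[of 1, simplified] induces_K_pm[of "- 1", simplified]
  have half: "(1/2) *\<^sub>R (B + B) = B" for B :: "real^5^5"
    by (simp flip: scaleR_2)
  \<comment> \<open>Sums and differences of the generators induce twice a standard basis matrix, so
    an array entry is half of such a combination.\<close>
  have eq: "Y = (1/2) *\<^sub>R Z" if "induces Z (B + B)" "induces Y B" for Y Z B
    using induces_unique_left[OF that(2)] induces_scaleR[OF that(1), of "1/2"] by (simp add: half)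
  have "M 1 4 = (1/2) *\<^sub>R (K_pm 1 - K_pm (- 1))"
    by (rule eq[OF _ induces_M]) (use induces_diff[OF ind(3,4)] in simp)
  moreover have "M 4 5 = (1/2) *\<^sub>R (- (K_pm 1 + K_pm (- 1)))"
    by (rule eq[OF _ induces_M]) (use induces_uminus[OF induces_add[OF ind(3,4)]] in simp)
  moreover have "M 3 4 = (1/2) *\<^sub>R (J_pm 1 - J_pm (- 1))"
    by (rule eq[OF _ induces_M]) (use induces_diff[OF ind(1,2)] in simp)
  moreover have "M 2 4 = (1/2) *\<^sub>R (- (J_pm 1 + J_pm (- 1)))"
    by (rule eq[OF _ induces_M]) (use induces_uminus[OF induces_add[OF ind(1,2)]] in simp)
  ultimately have M4_upper: "M 1 4 \<in> generated_alg" "M 4 5 \<in> generated_alg"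
    "M 3 4 \<in> generated_alg" "M 2 4 \<in> generated_alg"
    using gens by (auto intro!: subspace_scale subspace_add subspace_diff subspace_neg sub)
  have "M 5 4 \<in> generated_alg"
    unfolding M_array_swap[of 5 4] using M4_upper(2) by (rule subspace_neg[OF sub])
  moreover have "M 4 4 \<in> generated_alg"
    unfolding M_array_same by (rule subspace_0[OF sub])
  ultimately have M4: "M a 4 \<in> generated_alg" for a
    using exhaust_5[of a] M4_upper by (elim disjE; hypsubst)
  have M4': "M 4 a \<in> generated_alg" for a
    unfolding M_array_swap[of 4 a] using M4 by (rule subspace_neg[OF sub])
  have "M a b \<in> generated_alg" for a b
  proof (cases "a = 4 \<or> b = 4 \<or> a = b")
    case True
    then show ?thesis using M4 M4' M_array_same subspace_0[OF sub] by metis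
  next
    case False
    \<comment> \<open>With \<open>a\<close>, \<open>b\<close> and 4 distinct, only the term with
      \<open>g 4 4 = - 1\<close> survives, and its two signs cancel.\<close>
    then have "commutator (M a 4) (M b 4) = M a b"
      unfolding M_array_commutator by (simp add: Gamma_mat_3_2)
    then show ?thesis using br[OF M4 M4] by metis
  qed
  then show "so_ops \<subseteq> generated_alg" by (intro so_ops_subset sub)
qed

text \<open>\<open>induces_unique_right\<close> makes \<open>F\<close> well defined,
  \<open>induces_unique_left\<close> makes it injective, and \<open>induces_expansion\<close> makes
  it surjective. The second property lets its values on the array be read off
  \<open>induces_M\<close>.\<close>

lemma so_ops_lie_iso:
  obtains F where "lie_iso commutator so_ops mat_commutator (so 3 2 :: (real^5^5) set) F"
    "\<And>Y A. A \<in> so 3 2 \<Longrightarrow> induces Y A \<Longrightarrow> F Y = A"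
proof -
  define F where "F Y = (THE A. induces Y A)" for Y
  have F: "F Y = A" if "induces Y A" for Y A
    unfolding F_def using that by (blast intro: the_equality induces_unique_right)
  have F': "induces Y (F Y)" "F Y \<in> so 3 2" if "Y \<in> so_ops" for Y
    using that F unfolding so_ops_def by auto
  have "bij_betw F so_ops (so 3 2)"
  proof (rule bij_betw_imageI)
    show "inj_on F so_ops"
    proof (rule inj_onI)
      fix x y assume "x \<in> so_ops" "y \<in> so_ops" "F x = F y"
      then have "induces x (F x)" "induces y (F x)" using F'(1)[of x] F'(1)[of y] by simp_all
      then show "x = y" by (rule induces_unique_left)
    qed
    have "A \<in> F ` so_ops" if A: "A \<in> so 3 2" for A
    proof -
      obtain Y where Y: "induces Y A" using induces_expansion[OF A] by blast
      then have "Y \<in> so_ops" unfolding so_ops_def using A by blast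
      then show ?thesis using F[OF Y] by blast
    qed
    then show "F ` so_ops = so 3 2" using F'(2) by blast
  qed
  moreover have "F (x + y) = F x + F y" "F (commutator x y) = mat_commutator (F x) (F y)" if "x \<in> so_ops" "y \<in> so_ops" for x y
    using that by (simp_all add: F F'(1) induces_add induces_commutator)
  moreover have "F (s *\<^sub>R x) = s *\<^sub>R F x" if "x \<in> so_ops" for s x
    using that by (simp add: F F'(1) induces_scaleR)
  ultimately have "lie_iso commutator so_ops mat_commutator (so 3 2) F"
    unfolding lie_iso_def by blast
  then show thesis using F that by blast
qed

theorem theorem9p3:
  shows "(\<exists>F. lie_iso commutator generated_alg mat_commutator (so 3 2 :: (real^5^5) set) F
            \<and> (\<forall>a b. F (M_array $ a $ b) = so_gen 3 2 a b))
    \<and> inj_on (\<lambda>(a, b). M_array $ of_nat a $ of_nat b) {(a, b). 1 \<le> a \<and> a < b \<and> b \<le> (5::nat)}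
    \<and> independent {M_array $ of_nat a $ of_nat b | a b :: nat. 1 \<le> a \<and> a < b \<and> b \<le> 5}
    \<and> span {M_array $ of_nat a $ of_nat b | a b :: nat. 1 \<le> a \<and> a < b \<and> b \<le> 5} = generated_alg
    \<and> (\<forall>a b c d. commutator (M_array $ a $ b) (M_array $ c $ d) =
           (let g = (\<lambda>i j. (Gamma_mat 3 2 :: real^5^5) $ i $ j) in
            g a d *\<^sub>R M_array $ b $ c + g b c *\<^sub>R M_array $ a $ d
            - g a c *\<^sub>R M_array $ b $ d - g b d *\<^sub>R M_array $ a $ c))"
proof (intro conjI allI)
  obtain F where F: "lie_iso commutator so_ops mat_commutator (so 3 2 :: (real^5^5) set) F"
    "\<And>Y A. A \<in> so 3 2 \<Longrightarrow> induces Y A \<Longrightarrow> F Y = A"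
    using so_ops_lie_iso by blast
  then show "\<exists>F. lie_iso commutator generated_alg mat_commutator (so 3 2 :: (real^5^5) set) F
      \<and> (\<forall>a b. F (M_array $ a $ b) = so_gen 3 2 a b)"
    unfolding generated_alg_eq_so_ops using so_gen_in_so induces_M by blast
qed (simp_all only: inj_on_M_array image_upper independent_M_array span_M_array generated_alg_eq_so_ops
    M_array_commutator Let_def not_False_eq_True)

end
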